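(* Let $(A,P)$ be a relative Poisson algebra and $(\mu,\rho,V)$ be a compatible structure on $(A,P)$. Let $\beta:V\to V$ be a linear map which dually represents $(A,P)$ on $(\mu,\rho,V)$, so that $(-\mu^*,\rho^*,\beta^*,V^* )$ is a representation of $(A,P)$. Let $Q:A\to A$ and $\alpha:V\to V$ be linear maps. Let $T:V\to A$ be a linear map, identified with an element of $(A\ltimes_{-\mu^*,\rho^*}V^* )\otimes(A\ltimes_{-\mu^*,\rho^*}V^* )$ (namely $T=\sum_iT(v_i)\otimes v_i^*$ for a basis $\{v_i\}$ of $V$ with dual basis $\{v_i^*\}$). (1) $r=T-\tau(T)$ is an antisymmetric solution of the $(Q+\alpha^* )$-RPYBE in the relative Poisson algebra $(A\ltimes_{-\mu^*,\rho^*}V^*,P+\beta^* )$ if and only if $T$ is a weak $\mathcal O$-operator of $(A,P)$ associated to $(\mu,\rho,V)$ and $\alpha$, and satisfies $T\beta=QT$. (2) Assume that $(A,P)$ is dually represented by $Q$ and $(\mu,\rho,\alpha,V)$ is a representation of $(A,P)$. If $T$ is an $\mathcal O$-operator of $(A,P)$ associated to $(\mu,\rho,\alpha,V)$ satisfying $T\beta=QT$, then $r=T-\tau(T)$ is an antisymmetric solution of the $(Q+\alpha^* )$-RPYBE in the relative Poisson algebra $(A\ltimes_{-\mu^*,\rho^*}V^*,P+\beta^* )$. If in addition $$\mu(Q(x))v-\mu(x)\alpha(v)-\beta(\mu(x)v)=0,\qquad \rho(Q(x))v-\rho(x)\alpha(v)-\beta(\rho(x)v)=0$$ for all $x\in A$,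 $v\in V$, then $Q+\alpha^*$ dually represents the relative Poisson algebra $(A\ltimes_{-\mu^*,\rho^*}V^*,P+\beta^* )$. In this case, there is a relative Poisson bialgebra $(A\ltimes_{-\mu^*,\rho^*}V^*,\cdot,[-,-],\Delta,\delta,P+\beta^*,Q+\alpha^* )$, where, for $u\in A\ltimes_{-\mu^*,\rho^*}V^*$, $$\Delta(u)=(\mathrm{id}\otimes\mathcal L(u)-\mathcal L(u)\otimes\mathrm{id})r,\qquad \delta(u)=(\mathrm{ad}(u)\otimes\mathrm{id}+\mathrm{id}\otimes\mathrm{ad}(u))r,\qquad r=T-\tau(T).$$
   Context: All vector spaces are finite-dimensional over an algebraically closed field $\mathbb K$ of characteristic zero. Relative Poisson algebra. $(A,\cdot,[-,-],P)$, abbreviated $(A,P)$: $(A,\cdot)$ is a commutative associative (not necessarily unital) algebra, $(A,[-,-])$ is a Lie algebra, $P:A\to A$ is a linear map that is a derivation of both $\cdot$ and $[-,-]$, and $[z,x\cdot y]=[z,x]\cdot y+x\cdot[z,y]+x\cdot y\cdot P(z)$ for all $x,y,z\in A$. Notation. $\mathcal L(x)y=x\cdot y$, $\mathrm{ad}(x)y=[x,y]$, $\tau(x\otimes y)=y\otimes x$. For a linear map $\varphi:A\to\mathrm{End}(V)$, $\varphi^*:A\to\mathrm{End}(V^* )$ is defined by $\langle\varphi^*(x)u^*,v\rangle=-\langle u^*,\varphi(x)v\rangle$ (with a sign). For a linear map $S:V_1\to V_2$ between vector spaces, $S^*:V_2^*\to V_1^*$ is the usual dual map (no sign). For linear maps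 $\phi_i:V_i\to V_i$, $\phi_1+\phi_2$ is the map $v_1+v_2\mapsto\phi_1(v_1)+\phi_2(v_2)$ on $V_1\oplus V_2$. A compatible structure $(\mu,\rho,V)$ on $(A,P)$: linear maps $\mu,\rho:A\to\mathrm{End}(V)$ with $\mu(x\cdot y)=\mu(x)\mu(y)$, $\rho([x,y])=\rho(x)\rho(y)-\rho(y)\rho(x)$, $\rho(y)\mu(x)v-\mu(x)\rho(y)v+\mu([x,y])v-\mu(x\cdot P(y))v=0$. A representation $(\mu,\rho,\alpha,V)$ of $(A,P)$ is a compatible structure with a linear map $\alpha:V\to V$ such that $\alpha(\mu(x)v)=\mu(P(x))v+\mu(x)\alpha(v)$, $\alpha(\rho(x)v)=\rho(P(x))v+\rho(x)\alpha(v)$, $\rho(x\cdot y)v-\mu(x)\rho(y)v-\mu(y)\rho(x)v+\mu(x\cdot y)\alpha(v)=0$ (all $x,y\in A$, $v\in V$). For a representation, the semi-direct product $(A\ltimes_{\mu,\rho}V,P+\alpha)$ is the relative Poisson algebra on $A\oplus V$ with $(x+u)\cdot(y+v)=x\cdot y+\mu(x)v+\mu(y)u$, $[x+u,y+v]=[x,y]+\rho(x)v-\rho(y)u$. A linear map $\beta:V\to V$ dually represents $(A,P)$ on $(\mu,\rho,V)$ if $(-\mu^*,\rho^*,\beta^*,V^* )$ is a representation of $(A,P)$. A linear map $Q:A\to A$ dually represents $(A,P)$ (equivalently $(A,P)$ is dually represented by $Q$) if $(-\mathcal L^*,\mathrm{ad}^*,Q^*,A^* )$ is a representation of $(A,P)$.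 A weak $\mathcal O$-operator of $(A,P)$ associated to $(\mu,\rho,V)$ and $\alpha$ is a linear map $T:V\to A$ with $T(u)\cdot T(v)=T(\mu(T(u))v+\mu(T(v))u)$, $[T(u),T(v)]=T(\rho(T(u))v-\rho(T(v))u)$ for all $u,v\in V$, and $PT=T\alpha$. If in addition $(\mu,\rho,\alpha,V)$ is a representation, $T$ is an $\mathcal O$-operator associated to $(\mu,\rho,\alpha,V)$. RPYBE. For $r=\sum_ia_i\otimes b_i\in A\otimes A$ and a bilinear operation $\diamond$: $r_{12}\diamond r_{13}=\sum a_i\diamond a_j\otimes b_i\otimes b_j$, $r_{12}\diamond r_{23}=\sum a_i\otimes b_i\diamond a_j\otimes b_j$, $r_{13}\diamond r_{23}=\sum a_i\otimes a_j\otimes b_i\diamond b_j$. For a linear map $Q:A\to A$, $r$ is a solution of the $Q$-RPYBE in $(A,P)$ if $r_{12}\cdot r_{13}-r_{12}\cdot r_{23}+r_{13}\cdot r_{23}=0$, $[r_{12},r_{13}]+[r_{12},r_{23}]+[r_{13},r_{23}]=0$, $(P\otimes\mathrm{id}-\mathrm{id}\otimes Q)r=0$ and $(Q\otimes\mathrm{id}-\mathrm{id}\otimes P)r=0$. $r$ is antisymmetric if $r+\tau(r)=0$. Relative Poisson coalgebra $(A,\Delta,\delta,Q)$. Linear maps $\Delta,\delta:A\to A\otimes A$, $Q:A\to A$ with $\tau\Delta=\Delta$, $(\mathrm{id}\otimes\Delta)\Delta=(\Delta\otimes\mathrm{id})\Delta$; $\tau\delta=-\delta$, $(\mathrm{id}+\xi+\xi^2)(\mathrm{id}\otimes\delta)\delta=0$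 where $\xi(x\otimes y\otimes z)=y\otimes z\otimes x$; $\Delta Q=(Q\otimes\mathrm{id}+\mathrm{id}\otimes Q)\Delta$; $\delta Q=(Q\otimes\mathrm{id}+\mathrm{id}\otimes Q)\delta$; and $(\mathrm{id}\otimes\Delta)\delta(x)-(\delta\otimes\mathrm{id})\Delta(x)-(\tau\otimes\mathrm{id})(\mathrm{id}\otimes\delta)\Delta(x)-(Q\otimes\mathrm{id}\otimes\mathrm{id})(\Delta\otimes\mathrm{id})\Delta(x)=0$ for all $x\in A$. Relative Poisson bialgebra $(A,\cdot,[-,-],\Delta,\delta,P,Q)$. $(A,\cdot,[-,-],P)$ is a relative Poisson algebra; $(A,\Delta,\delta,Q)$ is a relative Poisson coalgebra; $Q$ dually represents $(A,P)$; $\Delta P=(P\otimes\mathrm{id}-\mathrm{id}\otimes Q)\Delta$, $\delta P=(P\otimes\mathrm{id}-\mathrm{id}\otimes Q)\delta$, $(\Delta\otimes\mathrm{id})\Delta(P+Q)=0$; and for all $x,y\in A$: $\Delta(x\cdot y)=(\mathcal L(x)\otimes\mathrm{id})\Delta(y)+(\mathrm{id}\otimes\mathcal L(y))\Delta(x)$; $\delta([x,y])=(\mathrm{ad}(x)\otimes\mathrm{id}+\mathrm{id}\otimes\mathrm{ad}(x))\delta(y)-(\mathrm{ad}(y)\otimes\mathrm{id}+\mathrm{id}\otimes\mathrm{ad}(y))\delta(x)$; $\delta(x\cdot y)-(\mathrm{id}\otimes\mathrm{ad}(y))\Delta(x)-(\mathcal L(x)\otimes\mathrm{id})\delta(y)-(\mathrm{id}\otimes\mathrm{ad}(x))\Delta(y)-(\mathcal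 L(y)\otimes\mathrm{id})\delta(x)-(\mathrm{id}\otimes Q)\Delta(x\cdot y)=0$; $\Delta([x,y])-(\mathcal L(y)\otimes\mathrm{id})\delta(x)-(\mathrm{id}\otimes\mathrm{ad}(x))\Delta(y)+(\mathrm{id}\otimes\mathcal L(y))\delta(x)-(\mathrm{ad}(x)\otimes\mathrm{id})\Delta(y)+\Delta(P(x)\cdot y)=0$. *)

theory Defs
  imports
    "HOL-Computational_Algebra.Polynomial"
    "HOL-Library.Function_Algebras"
    "HOL-Library.Product_Plus"
begin

section \<open>Vector spaces, linear maps, duals, direct sums\<close>

text \<open>A vector space is a linear subspace \<open>vcarrier\<close> of an ambient type carrying a vector space
  structure.  Explicit carriers are needed because the dual space of \<open>V\<close> and the tensor square of
  \<open>A\<close> are subspaces of function types.  Maps are only relevant on the carriers.\<close>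

record ('k, 'a) vsp =
  vcarrier :: "'a set"
  vscale :: "'k \<Rightarrow> 'a \<Rightarrow> 'a"

definition vspace :: "('k::field, 'a::ab_group_add, 'z) vsp_scheme \<Rightarrow> bool" where
  "vspace V \<longleftrightarrow> vector_space (vscale V) \<and> module.subspace (vscale V) (vcarrier V)"

definition basis_of :: "('k::field, 'a::ab_group_add, 'z) vsp_scheme \<Rightarrow> 'a set \<Rightarrow> bool" where
  "basis_of V B \<longleftrightarrow> \<not> module.dependent (vscale V) B \<and> module.span (vscale V) B = vcarrier V"

definition fd_vspace :: "('k::field, 'a::ab_group_add, 'z) vsp_scheme \<Rightarrow> bool" where
  "fd_vspace V \<longleftrightarrow> vspace V \<and> (\<exists>B. finite B \<and> basis_of V B)"

definition linmap :: "('k::field, 'a::ab_group_add, 'z) vsp_scheme \<Rightarrow>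
    ('k, 'b::ab_group_add, 'y) vsp_scheme \<Rightarrow> ('a \<Rightarrow> 'b) \<Rightarrow> bool" where
  "linmap V W f \<longleftrightarrow>
     (\<forall>x\<in>vcarrier V. f x \<in> vcarrier W) \<and>
     (\<forall>x\<in>vcarrier V. \<forall>y\<in>vcarrier V. f (x + y) = f x + f y) \<and>
     (\<forall>c. \<forall>x\<in>vcarrier V. f (vscale V c x) = vscale W c (f x))"

text \<open>A linear map \<open>A \<rightarrow> End(V)\<close> is the same as a curried bilinear map \<open>A \<times> V \<rightarrow> V\<close>.\<close>

definition bilinmap :: "('k::field, 'a::ab_group_add, 'z) vsp_scheme \<Rightarrow>
    ('k, 'b::ab_group_add, 'y) vsp_scheme \<Rightarrow> ('k, 'c::ab_group_add, 'x) vsp_scheme \<Rightarrow>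
    ('a \<Rightarrow> 'b \<Rightarrow> 'c) \<Rightarrow> bool" where
  "bilinmap U V W f \<longleftrightarrow>
     (\<forall>x\<in>vcarrier U. linmap V W (f x)) \<and> (\<forall>y\<in>vcarrier V. linmap U W (\<lambda>x. f x y))"

definition ground :: "('k::field, 'k) vsp" where
  "ground = \<lparr>vcarrier = UNIV, vscale = (*)\<rparr>"

text \<open>Functionals on the carrier of \<open>V\<close> are normalised to vanish outside it, so that equality of
  elements of the dual is equality of functions.\<close>

definition dual :: "('k::field, 'a::ab_group_add, 'z) vsp_scheme \<Rightarrow> ('k, 'a \<Rightarrow> 'k) vsp" where
  "dual V = \<lparr>vcarrier = {\<phi>. linmap V ground \<phi> \<and> (\<forall>x. x \<notin> vcarrier V \<longrightarrow> \<phi> x = 0)},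
             vscale = (\<lambda>c \<phi> x. c * \<phi> x)\<rparr>"

text \<open>The usual dual \<open>S\<^sup>* : W\<^sup>* \<rightarrow> V\<^sup>*\<close> of a linear map \<open>S : V \<rightarrow> W\<close> (no sign).\<close>

definition dual_map :: "('k::field, 'a, 'z) vsp_scheme \<Rightarrow> ('a \<Rightarrow> 'b) \<Rightarrow> ('b \<Rightarrow> 'k) \<Rightarrow> ('a \<Rightarrow> 'k)" where
  "dual_map V S \<phi> = (\<lambda>x. if x \<in> vcarrier V then \<phi> (S x) else 0)"

text \<open>The map \<open>\<phi>\<^sup>* : A \<rightarrow> End(V\<^sup>*)\<close> (with the sign) for \<open>\<phi> : A \<rightarrow> End(V)\<close>.\<close>

definition dual_action ::
  "('k::field, 'v, 'z) vsp_scheme \<Rightarrow> ('a \<Rightarrow> 'v \<Rightarrow> 'v) \<Rightarrow> 'a \<Rightarrow> ('v \<Rightarrow> 'k) \<Rightarrow> ('v \<Rightarrow> 'k)" where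
  "dual_action V \<phi> x u = (\<lambda>v. if v \<in> vcarrier V then - u (\<phi> x v) else 0)"


section \<open>Tensor products\<close>

text \<open>\<open>A \<otimes> B\<close> is realised as the span of the elementary tensors \<open>x \<otimes> y\<close>, where \<open>x \<otimes> y\<close> is the
  bilinear form \<open>(\<phi>, \<psi>) \<mapsto> \<phi>(x) \<psi>(y)\<close> on \<open>A\<^sup>* \<times> B\<^sup>*\<close> (and \<open>0\<close> off \<open>A\<^sup>* \<times> B\<^sup>*\<close>).  Since functionals
  separate points over a field, this is a model of the algebraic tensor product: see
  \<open>bilinmap_tens\<close> and \<open>tens_sum_eq_0\<close> below.  Elements of the triple tensor product are represented
  by trilinear forms in the same way, which makes the associator the identity.\<close>

definition tens :: "('k::field, 'a::ab_group_add, 'z) vsp_scheme \<Rightarrow>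
    ('k, 'b::ab_group_add, 'y) vsp_scheme \<Rightarrow> 'a \<Rightarrow> 'b \<Rightarrow> ('a \<Rightarrow> 'k) \<Rightarrow> ('b \<Rightarrow> 'k) \<Rightarrow> 'k" where
  "tens A B x y = (\<lambda>\<phi> \<psi>. if \<phi> \<in> vcarrier (dual A) \<and> \<psi> \<in> vcarrier (dual B) then \<phi> x * \<psi> y else 0)"

definition tensor :: "('k::field, 'a::ab_group_add, 'z) vsp_scheme \<Rightarrow>
    ('k, 'b::ab_group_add, 'y) vsp_scheme \<Rightarrow> ('k, ('a \<Rightarrow> 'k) \<Rightarrow> ('b \<Rightarrow> 'k) \<Rightarrow> 'k) vsp" where
  "tensor A B =
     \<lparr>vcarrier = module.span (\<lambda>c t \<phi> \<psi>. c * t \<phi> \<psi>)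
                   {tens A B x y | x y. x \<in> vcarrier A \<and> y \<in> vcarrier B},
      vscale = (\<lambda>c t \<phi> \<psi>. c * t \<phi> \<psi>)\<rparr>"

type_synonym ('k, 'a) tensor2 = "('a \<Rightarrow> 'k) \<Rightarrow> ('a \<Rightarrow> 'k) \<Rightarrow> 'k"
type_synonym ('k, 'a) tensor3 = "('a \<Rightarrow> 'k) \<Rightarrow> ('a \<Rightarrow> 'k) \<Rightarrow> ('a \<Rightarrow> 'k) \<Rightarrow> 'k"

definition on_dual3 :: "('k::field, 'a::ab_group_add, 'z) vsp_scheme \<Rightarrow>
    ('k, 'a) tensor3 \<Rightarrow> ('k, 'a) tensor3" where
  "on_dual3 A F = (\<lambda>\<phi> \<psi> \<chi>.
     if \<phi> \<in> vcarrier (dual A) \<and> \<psi> \<in> vcarrier (dual A) \<and> \<chi> \<in> vcarrier (dual A) then F \<phi> \<psi> \<chi> else 0)"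

definition tens3 :: "('k::field, 'a::ab_group_add, 'z) vsp_scheme \<Rightarrow>
    'a \<Rightarrow> 'a \<Rightarrow> 'a \<Rightarrow> ('k, 'a) tensor3" where
  "tens3 A x y z = on_dual3 A (\<lambda>\<phi> \<psi> \<chi>. \<phi> x * \<psi> y * \<chi> z)"

text \<open>\<open>f \<otimes> g\<close> for endomorphisms \<open>f\<close>, \<open>g\<close> of \<open>A\<close>, and the flip \<open>\<tau>\<close>.  The values of these and
  of the following maps on elementary tensors are computed in the lemmas at the end of the section.\<close>

definition tensor_map :: "('k::field, 'a::ab_group_add, 'z) vsp_scheme \<Rightarrow>
    ('a \<Rightarrow> 'a) \<Rightarrow> ('a \<Rightarrow> 'a) \<Rightarrow> ('k, 'a) tensor2 \<Rightarrow> ('k, 'a) tensor2" where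
  "tensor_map A f g t = (\<lambda>\<phi> \<psi>.
     if \<phi> \<in> vcarrier (dual A) \<and> \<psi> \<in> vcarrier (dual A)
     then t (dual_map A f \<phi>) (dual_map A g \<psi>) else 0)"

definition flip :: "('k, 'a) tensor2 \<Rightarrow> ('k, 'a) tensor2" where
  "flip t = (\<lambda>\<phi> \<psi>. t \<psi> \<phi>)"

text \<open>\<open>id \<otimes> D\<close> and \<open>D \<otimes> id\<close> for \<open>D : A \<rightarrow> A \<otimes> A\<close>.\<close>

definition id_tensor :: "('k::field, 'a::ab_group_add, 'z) vsp_scheme \<Rightarrow>
    ('a \<Rightarrow> ('k, 'a) tensor2) \<Rightarrow> ('k, 'a) tensor2 \<Rightarrow> ('k, 'a) tensor3" where
  "id_tensor A D t =
     on_dual3 A (\<lambda>\<phi> \<psi> \<chi>. t \<phi> (\<lambda>x. if x \<in> vcarrier A then D x \<psi> \<chi> else 0))"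

definition tensor_id :: "('k::field, 'a::ab_group_add, 'z) vsp_scheme \<Rightarrow>
    ('a \<Rightarrow> ('k, 'a) tensor2) \<Rightarrow> ('k, 'a) tensor2 \<Rightarrow> ('k, 'a) tensor3" where
  "tensor_id A D t =
     on_dual3 A (\<lambda>\<phi> \<psi> \<chi>. t (\<lambda>x. if x \<in> vcarrier A then D x \<phi> \<psi> else 0) \<chi>)"

text \<open>\<open>f \<otimes> id \<otimes> id\<close>, \<open>\<tau> \<otimes> id\<close>, and \<open>\<xi> (x \<otimes> y \<otimes> z) = y \<otimes> z \<otimes> x\<close>.\<close>

definition map_first :: "('k::field, 'a::ab_group_add, 'z) vsp_scheme \<Rightarrow>
    ('a \<Rightarrow> 'a) \<Rightarrow> ('k, 'a) tensor3 \<Rightarrow> ('k, 'a) tensor3" where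
  "map_first A f t = on_dual3 A (\<lambda>\<phi> \<psi> \<chi>. t (dual_map A f \<phi>) \<psi> \<chi>)"

definition flip12 :: "('k, 'a) tensor3 \<Rightarrow> ('k, 'a) tensor3" where
  "flip12 t = (\<lambda>\<phi> \<psi> \<chi>. t \<psi> \<phi> \<chi>)"

definition cyc :: "('k, 'a) tensor3 \<Rightarrow> ('k, 'a) tensor3" where
  "cyc t = (\<lambda>\<phi> \<psi> \<chi>. t \<chi> \<phi> \<psi>)"

text \<open>\<open>r\<^sub>1\<^sub>2 \<diamond> r\<^sub>1\<^sub>3\<close>, \<open>r\<^sub>1\<^sub>2 \<diamond> r\<^sub>2\<^sub>3\<close> and \<open>r\<^sub>1\<^sub>3 \<diamond> r\<^sub>2\<^sub>3\<close>: for \<open>r = \<Sum>\<^sub>i a\<^sub>i \<otimes> b\<^sub>i\<close> these contractions are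
  \<open>\<Sum>\<^sub>i\<^sub>j a\<^sub>i \<diamond> a\<^sub>j \<otimes> b\<^sub>i \<otimes> b\<^sub>j\<close>, \<open>\<Sum>\<^sub>i\<^sub>j a\<^sub>i \<otimes> b\<^sub>i \<diamond> a\<^sub>j \<otimes> b\<^sub>j\<close> and \<open>\<Sum>\<^sub>i\<^sub>j a\<^sub>i \<otimes> a\<^sub>j \<otimes> b\<^sub>i \<diamond> b\<^sub>j\<close>
  (lemmas \<open>prod_12_13_sum\<close>, \<open>prod_12_23_sum\<close>, \<open>prod_13_23_sum\<close>), independently of the
  decomposition of \<open>r\<close>.\<close>

definition prod_12_13 :: "('k::field, 'a::ab_group_add, 'z) vsp_scheme \<Rightarrow>
    ('a \<Rightarrow> 'a \<Rightarrow> 'a) \<Rightarrow> ('k, 'a) tensor2 \<Rightarrow> ('k, 'a) tensor3" where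
  "prod_12_13 A m r = on_dual3 A (\<lambda>\<phi> \<psi> \<chi>.
     r (\<lambda>x. if x \<in> vcarrier A
            then r (\<lambda>y. if y \<in> vcarrier A then \<phi> (m x y) else 0) \<chi> else 0) \<psi>)"

definition prod_12_23 :: "('k::field, 'a::ab_group_add, 'z) vsp_scheme \<Rightarrow>
    ('a \<Rightarrow> 'a \<Rightarrow> 'a) \<Rightarrow> ('k, 'a) tensor2 \<Rightarrow> ('k, 'a) tensor3" where
  "prod_12_23 A m r = on_dual3 A (\<lambda>\<phi> \<psi> \<chi>.
     r \<phi> (\<lambda>x. if x \<in> vcarrier A
              then r (\<lambda>y. if y \<in> vcarrier A then \<psi> (m x y) else 0) \<chi> else 0))"

definition prod_13_23 :: "('k::field, 'a::ab_group_add, 'z) vsp_scheme \<Rightarrow>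
    ('a \<Rightarrow> 'a \<Rightarrow> 'a) \<Rightarrow> ('k, 'a) tensor2 \<Rightarrow> ('k, 'a) tensor3" where
  "prod_13_23 A m r = on_dual3 A (\<lambda>\<phi> \<psi> \<chi>.
     r \<phi> (\<lambda>x. if x \<in> vcarrier A
              then r \<psi> (\<lambda>y. if y \<in> vcarrier A then \<chi> (m x y) else 0) else 0))"


subsection \<open>Elementary tensors\<close>

lemma vspace_closed:
  assumes "vspace V"
  shows "0 \<in> vcarrier V"
    and "x \<in> vcarrier V \<Longrightarrow> y \<in> vcarrier V \<Longrightarrow> x + y \<in> vcarrier V"
    and "x \<in> vcarrier V \<Longrightarrow> vscale V c x \<in> vcarrier V"
proof -
  interpret vector_space "vscale V" using assms by (simp add: vspace_def)
  have "subspace (vcarrier V)" using assms by (simp add: vspace_def)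
  then show "0 \<in> vcarrier V"
    and "x \<in> vcarrier V \<Longrightarrow> y \<in> vcarrier V \<Longrightarrow> x + y \<in> vcarrier V"
    and "x \<in> vcarrier V \<Longrightarrow> vscale V c x \<in> vcarrier V"
    by (auto simp: subspace_0 subspace_add subspace_scale)
qed

lemma mem_dual:
  "\<phi> \<in> vcarrier (dual V) \<longleftrightarrow>
     (\<forall>x\<in>vcarrier V. \<forall>y\<in>vcarrier V. \<phi> (x + y) = \<phi> x + \<phi> y) \<and>
     (\<forall>c. \<forall>x\<in>vcarrier V. \<phi> (vscale V c x) = c * \<phi> x) \<and>
     (\<forall>x. x \<notin> vcarrier V \<longrightarrow> \<phi> x = 0)"
  by (auto simp: dual_def linmap_def ground_def)

lemma mem_dual_guarded:
  assumes "vspace V"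
    and "\<And>x y. x \<in> vcarrier V \<Longrightarrow> y \<in> vcarrier V \<Longrightarrow> f (x + y) = f x + f y"
    and "\<And>c x. x \<in> vcarrier V \<Longrightarrow> f (vscale V c x) = c * f x"
  shows "(\<lambda>x. if x \<in> vcarrier V then f x else 0) \<in> vcarrier (dual V)"
  using assms(2,3) vspace_closed[OF assms(1)] by (auto simp: mem_dual)

lemma dual_map_mem:
  assumes "vspace V" "linmap V V f" "\<phi> \<in> vcarrier (dual V)"
  shows "dual_map V f \<phi> \<in> vcarrier (dual V)"
  unfolding dual_map_def
  by (rule mem_dual_guarded[OF assms(1)]) (use assms(2,3) in \<open>auto simp: linmap_def mem_dual\<close>)

lemma vector_space_tensor2:
  "vector_space (\<lambda>(c::'k::field) (t :: 'p \<Rightarrow> 'q \<Rightarrow> 'k) \<phi> \<psi>. c * t \<phi> \<psi>)"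
  by unfold_locales (auto simp: fun_eq_iff algebra_simps)

lemma bilinmap_tens:
  fixes A :: "('k::field, 'a::ab_group_add, 'z) vsp_scheme"
    and B :: "('k, 'b::ab_group_add, 'y) vsp_scheme"
  shows "bilinmap A B (tensor A B) (tens A B)"
proof -
  interpret T: vector_space
    "\<lambda>(c::'k) (t :: ('a \<Rightarrow> 'k) \<Rightarrow> ('b \<Rightarrow> 'k) \<Rightarrow> 'k) \<phi> \<psi>. c * t \<phi> \<psi>"
    by (rule vector_space_tensor2)
  have "tens A B x y \<in> vcarrier (tensor A B)" if "x \<in> vcarrier A" "y \<in> vcarrier B" for x y
    using that by (auto simp: tensor_def intro!: T.span_base)
  then show ?thesis
    by (auto simp: bilinmap_def linmap_def tens_def tensor_def fun_eq_iff mem_dual algebra_simps)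
qed

lemma functional_dual_to_independent:
  assumes V: "vspace V" and ind: "\<not> module.dependent (vscale V) S"
    and S: "S \<subseteq> vcarrier V" and a: "a \<in> S"
  shows "\<exists>\<phi>\<in>vcarrier (dual V). \<phi> a = 1 \<and> (\<forall>b\<in>S - {a}. \<phi> b = 0)"
proof -
  interpret vector_space "vscale V" using V by (simp add: vspace_def)
  let ?E = "extend_basis S"
  let ?\<phi> = "\<lambda>x. if x \<in> vcarrier V then representation ?E x a else 0"
  have E: "independent ?E" "span ?E = UNIV" "S \<subseteq> ?E"
    using ind independent_extend_basis span_extend_basis extend_basis_superset by auto
  have "?\<phi> \<in> vcarrier (dual V)"
    by (rule mem_dual_guarded[OF V]) (simp_all add: representation_add[OF E(1)] representation_scale[OF E(1)] E(2))
  moreover have "?\<phi> b = (if b = a then 1 else 0)" if "b \<in> S" for b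
    using that E S representation_basis[OF E(1), of b] by auto
  ultimately show ?thesis using a by (intro bexI[of _ ?\<phi>]) auto
qed

lemma tens_sum_eq_0:
  assumes "vspace A" "vspace B" "finite S" "S \<subseteq> vcarrier A" "\<not> module.dependent (vscale A) S"
    and "\<And>a. a \<in> S \<Longrightarrow> b a \<in> vcarrier B"
    and eq: "(\<Sum>a\<in>S. tens A B a (b a)) = 0" and a: "a \<in> S"
  shows "b a = 0"
proof (rule ccontr)
  assume nz: "b a \<noteq> 0"
  interpret B: vector_space "vscale B" using assms(2) by (simp add: vspace_def)
  obtain \<phi> where \<phi>: "\<phi> \<in> vcarrier (dual A)" "\<phi> a = 1" "\<forall>c\<in>S - {a}. \<phi> c = 0"
    using functional_dual_to_independent[OF assms(1,5,4) a] by auto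
  obtain \<psi> where \<psi>: "\<psi> \<in> vcarrier (dual B)" "\<psi> (b a) = 1"
    using functional_dual_to_independent[OF assms(2), of "{b a}" "b a"] nz assms(6)[OF a] by auto
  have "(\<Sum>c\<in>S. tens A B c (b c)) \<phi> \<psi> = (\<Sum>c\<in>S. \<phi> c * \<psi> (b c))"
    using \<open>finite S\<close> \<phi>(1) \<psi>(1) by (induction S) (auto simp: tens_def)
  also have "\<dots> = (\<Sum>c\<in>S. if c = a then 1 else 0)"
    using \<phi> \<psi> by (intro sum.cong) auto
  finally show False using eq a \<open>finite S\<close> by simp
qed

lemma tensor_map_tens:
  assumes "vspace A" "linmap A A f" "linmap A A g" "x \<in> vcarrier A" "y \<in> vcarrier A"
  shows "tensor_map A f g (tens A A x y) = tens A A (f x) (g y)"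
  using assms dual_map_mem[OF assms(1)]
  by (auto simp: tensor_map_def tens_def fun_eq_iff) (auto simp: dual_map_def)

lemma flip_tens: "flip (tens A A x y) = tens A A y x"
  by (auto simp: flip_def tens_def fun_eq_iff)

lemma map_first_tens3:
  assumes "vspace A" "linmap A A f" "x \<in> vcarrier A"
  shows "map_first A f (tens3 A x y z) = tens3 A (f x) y z"
  using assms dual_map_mem[OF assms(1)]
  by (auto simp: map_first_def tens3_def on_dual3_def fun_eq_iff) (auto simp: dual_map_def)

lemma flip12_tens3: "flip12 (tens3 A x y z) = tens3 A y x z"
  by (auto simp: flip12_def tens3_def on_dual3_def fun_eq_iff)

lemma cyc_tens3: "cyc (tens3 A x y z) = tens3 A y z x"
  by (auto simp: cyc_def tens3_def on_dual3_def fun_eq_iff)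

lemma
  assumes A: "vspace A" and D: "linmap A (tensor A A) D"
    and xy: "x \<in> vcarrier A" "y \<in> vcarrier A"
  shows id_tensor_tens: "id_tensor A D (tens A A x y) = on_dual3 A (\<lambda>\<phi> \<psi> \<chi>. \<phi> x * D y \<psi> \<chi>)"
    and tensor_id_tens: "tensor_id A D (tens A A x y) = on_dual3 A (\<lambda>\<phi> \<psi> \<chi>. D x \<phi> \<psi> * \<chi> y)"
proof -
  have "(\<lambda>x. if x \<in> vcarrier A then D x \<phi> \<psi> else 0) \<in> vcarrier (dual A)" for \<phi> \<psi>
    using D by (intro mem_dual_guarded[OF A]) (auto simp: linmap_def tensor_def)
  then show "id_tensor A D (tens A A x y) = on_dual3 A (\<lambda>\<phi> \<psi> \<chi>. \<phi> x * D y \<psi> \<chi>)"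
    and "tensor_id A D (tens A A x y) = on_dual3 A (\<lambda>\<phi> \<psi> \<chi>. D x \<phi> \<psi> * \<chi> y)"
    using xy by (auto simp: id_tensor_def tensor_id_def tens_def on_dual3_def fun_eq_iff)
qed

lemma sum_fun_apply: "(\<Sum>i\<in>I. f i) x = (\<Sum>i\<in>I. f i x)"
  by (induction I rule: infinite_finite_induct) auto

lemma
  assumes A: "vspace A" and m: "bilinmap A A A m"
    and ab: "\<And>i. i \<in> I \<Longrightarrow> a i \<in> vcarrier A" "\<And>i. i \<in> I \<Longrightarrow> b i \<in> vcarrier A"
  defines "r \<equiv> (\<Sum>i\<in>I. tens A A (a i) (b i))"
  shows prod_12_13_sum:
      "prod_12_13 A m r = (\<Sum>i\<in>I. \<Sum>j\<in>I. tens3 A (m (a i) (a j)) (b i) (b j))"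
    and prod_12_23_sum:
      "prod_12_23 A m r = (\<Sum>i\<in>I. \<Sum>j\<in>I. tens3 A (a i) (m (b i) (a j)) (b j))"
    and prod_13_23_sum:
      "prod_13_23 A m r = (\<Sum>i\<in>I. \<Sum>j\<in>I. tens3 A (a i) (a j) (m (b i) (b j)))"
proof -
  have r: "r \<phi> \<psi> = (\<Sum>i\<in>I. \<phi> (a i) * \<psi> (b i))"
    if "\<phi> \<in> vcarrier (dual A)" "\<psi> \<in> vcarrier (dual A)" for \<phi> \<psi>
    using that by (simp add: r_def sum_fun_apply tens_def)
  have fun1: "(\<lambda>y. if y \<in> vcarrier A then \<phi> (m x y) else 0) \<in> vcarrier (dual A)"
    if "\<phi> \<in> vcarrier (dual A)" "x \<in> vcarrier A" for \<phi> x
    using m that by (intro mem_dual_guarded[OF A]) (auto simp: bilinmap_def linmap_def mem_dual)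
  have inl: "r (\<lambda>y. if y \<in> vcarrier A then \<phi> (m x y) else 0) \<chi> = (\<Sum>j\<in>I. \<phi> (m x (a j)) * \<chi> (b j))"
    and inr: "r \<chi> (\<lambda>y. if y \<in> vcarrier A then \<phi> (m x y) else 0) = (\<Sum>j\<in>I. \<chi> (a j) * \<phi> (m x (b j)))"
    if "\<phi> \<in> vcarrier (dual A)" "\<chi> \<in> vcarrier (dual A)" "x \<in> vcarrier A" for \<phi> \<chi> x
    using that fun1[OF that(1,3)] ab by (simp_all add: r cong: sum.cong)
  have memsum: "(\<lambda>x. if x \<in> vcarrier A then \<Sum>j\<in>I. \<phi> (m x (c j)) * k j else 0) \<in> vcarrier (dual A)"
    if "\<phi> \<in> vcarrier (dual A)" "\<And>j. j \<in> I \<Longrightarrow> c j \<in> vcarrier A" for \<phi> c k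
  proof (rule mem_dual_guarded[OF A])
    show "(\<Sum>j\<in>I. \<phi> (m (x + y) (c j)) * k j) = (\<Sum>j\<in>I. \<phi> (m x (c j)) * k j) + (\<Sum>j\<in>I. \<phi> (m y (c j)) * k j)"
      if "x \<in> vcarrier A" "y \<in> vcarrier A" for x y
      unfolding sum.distrib[symmetric] using m that \<open>\<phi> \<in> _\<close> \<open>\<And>j. j \<in> I \<Longrightarrow> c j \<in> vcarrier A\<close>
      by (intro sum.cong) (auto simp: bilinmap_def linmap_def mem_dual algebra_simps)
    show "(\<Sum>j\<in>I. \<phi> (m (vscale A s x) (c j)) * k j) = s * (\<Sum>j\<in>I. \<phi> (m x (c j)) * k j)"
      if "x \<in> vcarrier A" for s x
      unfolding sum_distrib_left using m that \<open>\<phi> \<in> _\<close> \<open>\<And>j. j \<in> I \<Longrightarrow> c j \<in> vcarrier A\<close>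
      by (intro sum.cong) (auto simp: bilinmap_def linmap_def mem_dual algebra_simps)
  qed
  have out: "(\<lambda>x. if x \<in> vcarrier A then r (\<lambda>y. if y \<in> vcarrier A then \<phi> (m x y) else 0) \<chi> else 0)
      = (\<lambda>x. if x \<in> vcarrier A then \<Sum>j\<in>I. \<phi> (m x (a j)) * \<chi> (b j) else 0)"
    and out': "(\<lambda>x. if x \<in> vcarrier A then r \<chi> (\<lambda>y. if y \<in> vcarrier A then \<phi> (m x y) else 0) else 0)
      = (\<lambda>x. if x \<in> vcarrier A then \<Sum>j\<in>I. \<phi> (m x (b j)) * \<chi> (a j) else 0)"
    if "\<phi> \<in> vcarrier (dual A)" "\<chi> \<in> vcarrier (dual A)" for \<phi> \<chi>
    using that by (auto simp: inl inr mult.commute fun_eq_iff)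
  show "prod_12_13 A m r = (\<Sum>i\<in>I. \<Sum>j\<in>I. tens3 A (m (a i) (a j)) (b i) (b j))"
  proof (intro ext)
    fix \<phi> \<psi> \<chi>
    show "prod_12_13 A m r \<phi> \<psi> \<chi> = (\<Sum>i\<in>I. \<Sum>j\<in>I. tens3 A (m (a i) (a j)) (b i) (b j)) \<phi> \<psi> \<chi>"
      using ab memsum[of \<phi> a "\<lambda>j. \<chi> (b j)"]
      by (auto simp: prod_12_13_def on_dual3_def tens3_def sum_fun_apply out r sum_distrib_left
          sum_distrib_right mult_ac cong: sum.cong)
  qed
  show "prod_12_23 A m r = (\<Sum>i\<in>I. \<Sum>j\<in>I. tens3 A (a i) (m (b i) (a j)) (b j))"
  proof (intro ext)
    fix \<phi> \<psi> \<chi>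
    show "prod_12_23 A m r \<phi> \<psi> \<chi> = (\<Sum>i\<in>I. \<Sum>j\<in>I. tens3 A (a i) (m (b i) (a j)) (b j)) \<phi> \<psi> \<chi>"
      using ab memsum[of \<psi> a "\<lambda>j. \<chi> (b j)"]
      by (auto simp: prod_12_23_def on_dual3_def tens3_def sum_fun_apply out r sum_distrib_left
          sum_distrib_right mult_ac cong: sum.cong)
  qed
  show "prod_13_23 A m r = (\<Sum>i\<in>I. \<Sum>j\<in>I. tens3 A (a i) (a j) (m (b i) (b j)))"
  proof (intro ext)
    fix \<phi> \<psi> \<chi>
    show "prod_13_23 A m r \<phi> \<psi> \<chi> = (\<Sum>i\<in>I. \<Sum>j\<in>I. tens3 A (a i) (a j) (m (b i) (b j))) \<phi> \<psi> \<chi>"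
      using ab memsum[of \<chi> b "\<lambda>j. \<psi> (a j)"]
      by (auto simp: prod_13_23_def on_dual3_def tens3_def sum_fun_apply out' r sum_distrib_left
          sum_distrib_right mult_ac cong: sum.cong)
  qed
qed


section \<open>Relative Poisson algebras and their representations\<close>

record ('k, 'a) rpa = "('k, 'a) vsp" +
  mul :: "'a \<Rightarrow> 'a \<Rightarrow> 'a"
  brk :: "'a \<Rightarrow> 'a \<Rightarrow> 'a"
  der :: "'a \<Rightarrow> 'a"

definition comm_assoc_algebra ::
  "('k::field, 'a::ab_group_add, 'z) vsp_scheme \<Rightarrow> ('a \<Rightarrow> 'a \<Rightarrow> 'a) \<Rightarrow> bool" where
  "comm_assoc_algebra A m \<longleftrightarrow> bilinmap A A A m \<and>
     (\<forall>x\<in>vcarrier A. \<forall>y\<in>vcarrier A. m x y = m y x) \<and>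
     (\<forall>x\<in>vcarrier A. \<forall>y\<in>vcarrier A. \<forall>z\<in>vcarrier A. m (m x y) z = m x (m y z))"

definition lie_algebra ::
  "('k::field, 'a::ab_group_add, 'z) vsp_scheme \<Rightarrow> ('a \<Rightarrow> 'a \<Rightarrow> 'a) \<Rightarrow> bool" where
  "lie_algebra A b \<longleftrightarrow> bilinmap A A A b \<and>
     (\<forall>x\<in>vcarrier A. b x x = 0) \<and>
     (\<forall>x\<in>vcarrier A. \<forall>y\<in>vcarrier A. \<forall>z\<in>vcarrier A. b x (b y z) + b y (b z x) + b z (b x y) = 0)"

definition derivation ::
  "('k::field, 'a::ab_group_add, 'z) vsp_scheme \<Rightarrow> ('a \<Rightarrow> 'a \<Rightarrow> 'a) \<Rightarrow> ('a \<Rightarrow> 'a) \<Rightarrow> bool" where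
  "derivation A m P \<longleftrightarrow> linmap A A P \<and>
     (\<forall>x\<in>vcarrier A. \<forall>y\<in>vcarrier A. P (m x y) = m (P x) y + m x (P y))"

definition relative_poisson_algebra :: "('k::field, 'a::ab_group_add, 'z) rpa_scheme \<Rightarrow> bool" where
  "relative_poisson_algebra A \<longleftrightarrow>
     fd_vspace A \<and> comm_assoc_algebra A (mul A) \<and> lie_algebra A (brk A) \<and>
     derivation A (mul A) (der A) \<and> derivation A (brk A) (der A) \<and>
     (\<forall>x\<in>vcarrier A. \<forall>y\<in>vcarrier A. \<forall>z\<in>vcarrier A.
        brk A z (mul A x y) =
          mul A (brk A z x) y + mul A x (brk A z y) + mul A (mul A x y) (der A z))"

definition compatible_structure :: "('k::field, 'a::ab_group_add, 'z) rpa_scheme \<Rightarrow>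
    ('k, 'v::ab_group_add, 'y) vsp_scheme \<Rightarrow> ('a \<Rightarrow> 'v \<Rightarrow> 'v) \<Rightarrow> ('a \<Rightarrow> 'v \<Rightarrow> 'v) \<Rightarrow> bool" where
  "compatible_structure A V \<mu> \<rho> \<longleftrightarrow>
     fd_vspace V \<and> bilinmap A V V \<mu> \<and> bilinmap A V V \<rho> \<and>
     (\<forall>x\<in>vcarrier A. \<forall>y\<in>vcarrier A. \<forall>v\<in>vcarrier V.
        \<mu> (mul A x y) v = \<mu> x (\<mu> y v) \<and>
        \<rho> (brk A x y) v = \<rho> x (\<rho> y v) - \<rho> y (\<rho> x v) \<and>
        \<rho> y (\<mu> x v) - \<mu> x (\<rho> y v) + \<mu> (brk A x y) v - \<mu> (mul A x (der A y)) v = 0)"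

definition rpa_rep :: "('k::field, 'a::ab_group_add, 'z) rpa_scheme \<Rightarrow>
    ('k, 'v::ab_group_add, 'y) vsp_scheme \<Rightarrow> ('a \<Rightarrow> 'v \<Rightarrow> 'v) \<Rightarrow> ('a \<Rightarrow> 'v \<Rightarrow> 'v) \<Rightarrow> ('v \<Rightarrow> 'v) \<Rightarrow> bool"
  where
  "rpa_rep A V \<mu> \<rho> \<alpha> \<longleftrightarrow>
     compatible_structure A V \<mu> \<rho> \<and> linmap V V \<alpha> \<and>
     (\<forall>x\<in>vcarrier A. \<forall>v\<in>vcarrier V. \<alpha> (\<mu> x v) = \<mu> (der A x) v + \<mu> x (\<alpha> v)) \<and>
     (\<forall>x\<in>vcarrier A. \<forall>v\<in>vcarrier V. \<alpha> (\<rho> x v) = \<rho> (der A x) v + \<rho> x (\<alpha> v)) \<and>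
     (\<forall>x\<in>vcarrier A. \<forall>y\<in>vcarrier A. \<forall>v\<in>vcarrier V.
        \<rho> (mul A x y) v - \<mu> x (\<rho> y v) - \<mu> y (\<rho> x v) + \<mu> (mul A x y) (\<alpha> v) = 0)"

text \<open>The semi-direct product \<open>(A \<ltimes> V, P + \<alpha>)\<close> on \<open>A \<oplus> V\<close>.\<close>

definition semidirect :: "('k::field, 'a::ab_group_add, 'z) rpa_scheme \<Rightarrow>
    ('k, 'v::ab_group_add, 'y) vsp_scheme \<Rightarrow> ('a \<Rightarrow> 'v \<Rightarrow> 'v) \<Rightarrow> ('a \<Rightarrow> 'v \<Rightarrow> 'v) \<Rightarrow> ('v \<Rightarrow> 'v) \<Rightarrow>
    ('k, 'a \<times> 'v) rpa" where
  "semidirect A V \<mu> \<rho> \<alpha> =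
     \<lparr>vcarrier = vcarrier A \<times> vcarrier V,
      vscale = (\<lambda>c (x, u). (vscale A c x, vscale V c u)),
      mul = (\<lambda>(x, u) (y, v). (mul A x y, \<mu> x v + \<mu> y u)),
      brk = (\<lambda>(x, u) (y, v). (brk A x y, \<rho> x v - \<rho> y u)),
      der = map_prod (der A) \<alpha>\<rparr>"

text \<open>\<open>\<beta>\<close> dually represents \<open>(A, P)\<close> on \<open>(\<mu>, \<rho>, V)\<close> if \<open>(-\<mu>\<^sup>*, \<rho>\<^sup>*, \<beta>\<^sup>*, V\<^sup>*)\<close> is a representation;
  \<open>Q\<close> dually represents \<open>(A, P)\<close> if \<open>(-\<L>\<^sup>*, ad\<^sup>*, Q\<^sup>*, A\<^sup>*)\<close> is.\<close>

definition dually_represents_on :: "('k::field, 'a::ab_group_add, 'z) rpa_scheme \<Rightarrow>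
    ('k, 'v::ab_group_add, 'y) vsp_scheme \<Rightarrow> ('a \<Rightarrow> 'v \<Rightarrow> 'v) \<Rightarrow> ('a \<Rightarrow> 'v \<Rightarrow> 'v) \<Rightarrow> ('v \<Rightarrow> 'v) \<Rightarrow> bool"
  where
  "dually_represents_on A V \<mu> \<rho> \<beta> \<longleftrightarrow> linmap V V \<beta> \<and>
     rpa_rep A (dual V) (- dual_action V \<mu>) (dual_action V \<rho>) (dual_map V \<beta>)"

definition dually_represents ::
  "('k::field, 'a::ab_group_add, 'z) rpa_scheme \<Rightarrow> ('a \<Rightarrow> 'a) \<Rightarrow> bool" where
  "dually_represents A Q \<longleftrightarrow> linmap A A Q \<and>
     rpa_rep A (dual A) (- dual_action A (mul A)) (dual_action A (brk A)) (dual_map A Q)"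

definition weak_O_operator :: "('k::field, 'a::ab_group_add, 'z) rpa_scheme \<Rightarrow>
    ('k, 'v::ab_group_add, 'y) vsp_scheme \<Rightarrow> ('a \<Rightarrow> 'v \<Rightarrow> 'v) \<Rightarrow> ('a \<Rightarrow> 'v \<Rightarrow> 'v) \<Rightarrow> ('v \<Rightarrow> 'v) \<Rightarrow>
    ('v \<Rightarrow> 'a) \<Rightarrow> bool" where
  "weak_O_operator A V \<mu> \<rho> \<alpha> T \<longleftrightarrow> linmap V A T \<and>
     (\<forall>u\<in>vcarrier V. \<forall>v\<in>vcarrier V.
        mul A (T u) (T v) = T (\<mu> (T u) v + \<mu> (T v) u) \<and>
        brk A (T u) (T v) = T (\<rho> (T u) v - \<rho> (T v) u)) \<and>
     (\<forall>v\<in>vcarrier V. der A (T v) = T (\<alpha> v))"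

definition O_operator :: "('k::field, 'a::ab_group_add, 'z) rpa_scheme \<Rightarrow>
    ('k, 'v::ab_group_add, 'y) vsp_scheme \<Rightarrow> ('a \<Rightarrow> 'v \<Rightarrow> 'v) \<Rightarrow> ('a \<Rightarrow> 'v \<Rightarrow> 'v) \<Rightarrow> ('v \<Rightarrow> 'v) \<Rightarrow>
    ('v \<Rightarrow> 'a) \<Rightarrow> bool" where
  "O_operator A V \<mu> \<rho> \<alpha> T \<longleftrightarrow> rpa_rep A V \<mu> \<rho> \<alpha> \<and> weak_O_operator A V \<mu> \<rho> \<alpha> T"


section \<open>The relative Poisson Yang-Baxter equation\<close>

definition rpybe_solution :: "('k::field, 'a::ab_group_add, 'z) rpa_scheme \<Rightarrow> ('a \<Rightarrow> 'a) \<Rightarrow>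
    ('k, 'a) tensor2 \<Rightarrow> bool" where
  "rpybe_solution A Q r \<longleftrightarrow> r \<in> vcarrier (tensor A A) \<and>
     prod_12_13 A (mul A) r - prod_12_23 A (mul A) r + prod_13_23 A (mul A) r = 0 \<and>
     prod_12_13 A (brk A) r + prod_12_23 A (brk A) r + prod_13_23 A (brk A) r = 0 \<and>
     tensor_map A (der A) id r - tensor_map A id Q r = 0 \<and>
     tensor_map A Q id r - tensor_map A id (der A) r = 0"

definition antisymmetric_tensor :: "('k::field, 'a) tensor2 \<Rightarrow> bool" where
  "antisymmetric_tensor r \<longleftrightarrow> r + flip r = 0"

text \<open>The element \<open>\<Sum>\<^sub>i T(v\<^sub>i) \<otimes> v\<^sub>i\<^sup>*\<close> of \<open>(A \<oplus> V\<^sup>*) \<otimes> (A \<oplus> V\<^sup>*)\<close>, where \<open>W\<close> is a structure on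
  \<open>A \<oplus> V\<^sup>*\<close>, for a basis \<open>B = {v\<^sub>i}\<close> of \<open>V\<close>.  The functional \<open>v\<^sub>i\<^sup>*\<close> sends \<open>x\<close> to the
  coefficient of \<open>v\<^sub>i\<close> in \<open>x\<close>; the library's \<open>representation\<close> is \<open>0\<close> off the span of \<open>B\<close>.\<close>

definition map_tensor :: "('k::field, 'a::ab_group_add \<times> ('v::ab_group_add \<Rightarrow> 'k), 'z) vsp_scheme \<Rightarrow>
    ('k, 'v, 'y) vsp_scheme \<Rightarrow> 'v set \<Rightarrow> ('v \<Rightarrow> 'a) \<Rightarrow> ('k, 'a \<times> ('v \<Rightarrow> 'k)) tensor2" where
  "map_tensor W V B T =
     (\<Sum>v\<in>B. tens W W (T v, 0) (0, \<lambda>x. module.representation (vscale V) B x v))"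


section \<open>Relative Poisson coalgebras and bialgebras\<close>

definition relative_poisson_coalgebra :: "('k::field, 'a::ab_group_add, 'z) vsp_scheme \<Rightarrow>
    ('a \<Rightarrow> ('k, 'a) tensor2) \<Rightarrow> ('a \<Rightarrow> ('k, 'a) tensor2) \<Rightarrow> ('a \<Rightarrow> 'a) \<Rightarrow> bool" where
  "relative_poisson_coalgebra A \<Delta> \<delta> Q \<longleftrightarrow>
     fd_vspace A \<and> linmap A (tensor A A) \<Delta> \<and> linmap A (tensor A A) \<delta> \<and> linmap A A Q \<and>
     (\<forall>x\<in>vcarrier A.
        flip (\<Delta> x) = \<Delta> x \<and>
        id_tensor A \<Delta> (\<Delta> x) = tensor_id A \<Delta> (\<Delta> x) \<and>
        flip (\<delta> x) = - \<delta> x \<and>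
        id_tensor A \<delta> (\<delta> x) + cyc (id_tensor A \<delta> (\<delta> x)) + cyc (cyc (id_tensor A \<delta> (\<delta> x))) = 0 \<and>
        \<Delta> (Q x) = tensor_map A Q id (\<Delta> x) + tensor_map A id Q (\<Delta> x) \<and>
        \<delta> (Q x) = tensor_map A Q id (\<delta> x) + tensor_map A id Q (\<delta> x) \<and>
        id_tensor A \<Delta> (\<delta> x) - tensor_id A \<delta> (\<Delta> x) - flip12 (id_tensor A \<delta> (\<Delta> x))
          - map_first A Q (tensor_id A \<Delta> (\<Delta> x)) = 0)"

definition relative_poisson_bialgebra :: "('k::field, 'a::ab_group_add, 'z) rpa_scheme \<Rightarrow>
    ('a \<Rightarrow> ('k, 'a) tensor2) \<Rightarrow> ('a \<Rightarrow> ('k, 'a) tensor2) \<Rightarrow> ('a \<Rightarrow> 'a) \<Rightarrow> bool" where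
  "relative_poisson_bialgebra A \<Delta> \<delta> Q \<longleftrightarrow>
     relative_poisson_algebra A \<and> relative_poisson_coalgebra A \<Delta> \<delta> Q \<and> dually_represents A Q \<and>
     (\<forall>x\<in>vcarrier A.
        \<Delta> (der A x) = tensor_map A (der A) id (\<Delta> x) - tensor_map A id Q (\<Delta> x) \<and>
        \<delta> (der A x) = tensor_map A (der A) id (\<delta> x) - tensor_map A id Q (\<delta> x) \<and>
        tensor_id A \<Delta> (\<Delta> (der A x + Q x)) = 0) \<and>
     (\<forall>x\<in>vcarrier A. \<forall>y\<in>vcarrier A.
        \<Delta> (mul A x y) = tensor_map A (mul A x) id (\<Delta> y) + tensor_map A id (mul A y) (\<Delta> x) \<and>
        \<delta> (brk A x y) =
          (tensor_map A (brk A x) id (\<delta> y) + tensor_map A id (brk A x) (\<delta> y))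
          - (tensor_map A (brk A y) id (\<delta> x) + tensor_map A id (brk A y) (\<delta> x)) \<and>
        \<delta> (mul A x y) - tensor_map A id (brk A y) (\<Delta> x) - tensor_map A (mul A x) id (\<delta> y)
          - tensor_map A id (brk A x) (\<Delta> y) - tensor_map A (mul A y) id (\<delta> x)
          - tensor_map A id Q (\<Delta> (mul A x y)) = 0 \<and>
        \<Delta> (brk A x y) - tensor_map A (mul A y) id (\<delta> x) - tensor_map A id (brk A x) (\<Delta> y)
          + tensor_map A id (mul A y) (\<delta> x) - tensor_map A (brk A x) id (\<Delta> y)
          + \<Delta> (mul A (der A x) y) = 0)"

end

theory Submission
  imports Defs
begin

text \<open>An antisymmetric tensor \<open>r \<in> W \<otimes> W\<close> is the same thing as a linear map \<open>R : W\<^sup>* \<rightarrow> W\<close> with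
  \<open>r(\<phi>, \<psi>) = \<phi>(R\<psi>) = - \<psi>(R\<phi>)\<close>, and everything becomes transparent in terms of \<open>R\<close>.  The two
  quadratic parts of the Yang-Baxter equation turn into the trilinear identities
  \<open>\<phi>(R\<psi> \<cdot> R\<chi>) + \<psi>(R\<phi> \<cdot> R\<chi>) + \<chi>(R\<phi> \<cdot> R\<psi>) = 0\<close> and
  \<open>\<phi>[R\<psi>, R\<chi>] - \<psi>[R\<phi>, R\<chi>] + \<chi>[R\<phi>, R\<psi>] = 0\<close>, and the two linear parts say that \<open>R\<close>
  intertwines the transpose of \<open>Q\<close> with \<open>P\<close> and the transpose of \<open>P\<close> with \<open>Q\<close>
  (\<open>rpybe_solution_iff_operator\<close>).

  A functional on \<open>A \<oplus> V\<^sup>*\<close> is a pair \<open>(f, u)\<close> with \<open>f \<in> A\<^sup>*\<close> and, as \<open>V\<close> is reflexive, \<open>u \<in> V\<close>.  For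
  \<open>r = T - \<tau>(T)\<close> one finds \<open>r((f, u), (g, v)) = f(Tv) - g(Tu)\<close>, so \<open>R(g, v) = (Tv, - T\<^sup>*g)\<close>.
  Substituting this, the trilinear identities split into three copies of the two quadratic
  conditions on a weak \<open>\<O>\<close>-operator, one for each position of the functional on \<open>A\<close>, and the
  intertwining conditions become \<open>PT = T\<alpha>\<close> and \<open>T\<beta> = QT\<close>.  This is
  \<open>rpybe_iff_weak_O_operator\<close>, the first part of the theorem.

  For the second part, the dual representation conditions are first transposed back to
  identities between elements (\<open>dually_represents_on_iff\<close>).  In this form the conditions for
  \<open>Q + \<alpha>\<^sup>*\<close> on the semi-direct product decompose into those for \<open>Q\<close>, those for the representation
  \<open>\<alpha>\<close>, and the two additional equations (\<open>dually_represents_semidirect\<close>).  The bialgebra is then an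
  instance of \<open>coboundary_bialgebra\<close>, which holds for every antisymmetric solution of the
  \<open>Q\<close>-Yang-Baxter equation in an algebra that \<open>Q\<close> dually represents.  Its proof evaluates each axiom on functionals: up to sign, \<open>\<Delta>\<close> and \<open>\<delta>\<close>
  are dual to operations \<open>\<phi> * \<psi>\<close> and \<open>{\<phi>, \<psi>}\<close> on the dual space for which the Yang-Baxter equation makes
  \<open>R\<close> multiplicative, \<open>R(\<phi> * \<psi>) = R\<phi> \<cdot> R\<psi>\<close> and \<open>R{\<phi>, \<psi>} = [R\<phi>, R\<psi>]\<close>.  Every axiom thereby
  reduces to an identity in the algebra under each of the functionals involved.\<close>

section \<open>Linear algebra on carriers\<close>

lemma carrier_uminus:
  assumes "vspace V" "x \<in> vcarrier V" shows "- x \<in> vcarrier V"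
proof -
  interpret vector_space "vscale V" using assms by (simp add: vspace_def)
  show ?thesis using assms by (simp add: vspace_def subspace_neg)
qed

lemma carrier_diff:
  assumes "vspace V" "x \<in> vcarrier V" "y \<in> vcarrier V" shows "x - y \<in> vcarrier V"
  using vspace_closed(2)[OF assms(1,2) carrier_uminus[OF assms(1,3)]] by simp

lemma carrier_sum:
  assumes "vspace V" "\<And>i. i \<in> I \<Longrightarrow> f i \<in> vcarrier V" shows "sum f I \<in> vcarrier V"
  using assms(2) vspace_closed(1,2)[OF assms(1)] by (induction I rule: infinite_finite_induct) auto

lemma linmap_zero:
  assumes "vspace V" "linmap V W f" shows "f 0 = 0"
  using assms(2) vspace_closed(1)[OF assms(1)] unfolding linmap_def by (metis add_cancel_right_left add.right_neutral)

lemma linmap_uminus: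
  assumes "vspace V" "linmap V W f" "x \<in> vcarrier V" shows "f (- x) = - f x"
proof -
  have "f (x + - x) = f x + f (- x)"
    using assms(2,3) carrier_uminus[OF assms(1,3)] unfolding linmap_def by blast
  then show ?thesis using linmap_zero[OF assms(1,2)] by (simp add: eq_neg_iff_add_eq_0 add.commute)
qed

lemma linmap_diff:
  assumes "vspace V" "linmap V W f" "x \<in> vcarrier V" "y \<in> vcarrier V" shows "f (x - y) = f x - f y"
proof -
  have "f (x + - y) = f x + f (- y)"
    using assms(2,3) carrier_uminus[OF assms(1,4)] unfolding linmap_def by blast
  then show ?thesis using linmap_uminus[OF assms(1,2,4)] by simp
qed

lemma linmap_sum:
  assumes "vspace V" "linmap V W f" "\<And>i. i \<in> I \<Longrightarrow> g i \<in> vcarrier V"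
  shows "f (\<Sum>i\<in>I. g i) = (\<Sum>i\<in>I. f (g i))"
  using assms(3)
proof (induction I rule: infinite_finite_induct)
  case (insert x F)
  then show ?case using carrier_sum[OF assms(1), of F g] assms(2) by (simp add: linmap_def)
qed (simp_all add: linmap_zero[OF assms(1,2)])

lemma dual_linmap: "\<phi> \<in> vcarrier (dual V) \<Longrightarrow> linmap V ground \<phi>"
  by (simp add: dual_def)

lemma dual_add:
  "\<phi> \<in> vcarrier (dual V) \<Longrightarrow> x \<in> vcarrier V \<Longrightarrow> y \<in> vcarrier V \<Longrightarrow> \<phi> (x + y) = \<phi> x + \<phi> y"
  by (simp add: mem_dual)

lemma dual_scale: "\<phi> \<in> vcarrier (dual V) \<Longrightarrow> x \<in> vcarrier V \<Longrightarrow> \<phi> (vscale V c x) = c * \<phi> x"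
  by (simp add: mem_dual)

lemma dual_off: "\<phi> \<in> vcarrier (dual V) \<Longrightarrow> x \<notin> vcarrier V \<Longrightarrow> \<phi> x = 0"
  by (simp add: mem_dual)

lemmas dual_zero = linmap_zero[OF _ dual_linmap]
lemmas dual_uminus = linmap_uminus[OF _ dual_linmap]
lemmas dual_diff = linmap_diff[OF _ dual_linmap]
lemmas dual_sum = linmap_sum[OF _ dual_linmap]

lemma dual_eqI:
  assumes "\<phi> \<in> vcarrier (dual V)" "\<psi> \<in> vcarrier (dual V)" "\<And>x. x \<in> vcarrier V \<Longrightarrow> \<phi> x = \<psi> x"
  shows "\<phi> = \<psi>"
proof (rule ext)
  fix x show "\<phi> x = \<psi> x"
    using assms dual_off[OF assms(1)] dual_off[OF assms(2)] by (cases "x \<in> vcarrier V") simp_all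
qed

text \<open>Functionals separate points.  This is how identities between elements are recovered from their
  evaluations throughout.\<close>

lemma dual_separates:
  assumes V: "vspace V" and x: "x \<in> vcarrier V" and y: "y \<in> vcarrier V"
    and eq: "\<And>\<phi>. \<phi> \<in> vcarrier (dual V) \<Longrightarrow> \<phi> x = \<phi> y"
  shows "x = y"
proof (rule ccontr)
  interpret vector_space "vscale V" using V by (simp add: vspace_def)
  assume "x \<noteq> y"
  then obtain \<phi> where "\<phi> \<in> vcarrier (dual V)" "\<phi> (x - y) = 1"
    using functional_dual_to_independent[OF V, of "{x - y}" "x - y"] carrier_diff[OF V x y] by auto
  then show False using eq[of \<phi>] dual_diff[OF V _ x y, of \<phi>] by simp
qed

lemma vspace_dual:
  assumes V: "vspace V" shows "vspace (dual V)"
proof -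
  interpret vector_space "vscale (dual V)"
    by unfold_locales (auto simp: dual_def fun_eq_iff algebra_simps)
  have "subspace (vcarrier (dual V))"
    unfolding subspace_def by (auto simp: mem_dual) (auto simp: dual_def algebra_simps)
  then show ?thesis by (simp add: vspace_def vector_space_axioms)
qed

text \<open>A finite spanning set suffices, because it contains a basis.\<close>

lemma fd_vspaceI:
  assumes V: "vspace V" and S: "finite S" "module.span (vscale V) S = vcarrier V"
  shows "fd_vspace V"
proof -
  interpret vector_space "vscale V" using V by (simp add: vspace_def)
  obtain B where B: "B \<subseteq> S" "independent B" "S \<subseteq> span B" using maximal_independent_subset by blast
  have "span B = span S" using B by (meson span_mono span_minimal subspace_span subset_antisym)
  then have "basis_of V B" using B S by (simp add: basis_of_def)
  then show ?thesis using B(1) S(1) V finite_subset unfolding fd_vspace_def by blast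
qed

lemma basis_of_finite:
  assumes "fd_vspace V" "basis_of V B" shows "finite B"
proof -
  interpret vector_space "vscale V" using assms by (simp add: vspace_def fd_vspace_def)
  obtain C where "finite C" "span C = vcarrier V" using assms by (auto simp: fd_vspace_def basis_of_def)
  then show ?thesis using assms(2) independent_span_bound[of C B] span_superset
    by (auto simp: basis_of_def)
qed

lemma fd_vspace: "fd_vspace V \<Longrightarrow> vspace V"
  by (simp add: fd_vspace_def)

abbreviation coordinate :: "('k::field, 'a::ab_group_add, 'z) vsp_scheme \<Rightarrow> 'a set \<Rightarrow> 'a \<Rightarrow> 'a \<Rightarrow> 'k" where
  "coordinate V B v \<equiv> (\<lambda>x. module.representation (vscale V) B x v)"

lemma coordinate_mem_dual:
  assumes V: "vspace V" and B: "basis_of V B" shows "coordinate V B v \<in> vcarrier (dual V)"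
proof -
  interpret vector_space "vscale V" using V by (simp add: vspace_def)
  have B': "independent B" "span B = vcarrier V" using B by (simp_all add: basis_of_def)
  show ?thesis using B'
    by (simp add: mem_dual representation_add[OF B'(1)] representation_scale[OF B'(1)])
      (simp add: representation_def)
qed

lemma coordinate_expansion:
  assumes V: "vspace V" and B: "basis_of V B" "finite B" and x: "x \<in> vcarrier V"
  shows "x = (\<Sum>v\<in>B. vscale V (coordinate V B v x) v)"
proof -
  interpret vector_space "vscale V" using V by (simp add: vspace_def)
  show ?thesis using sum_representation_eq[of B x B] B x by (auto simp: basis_of_def)
qed

lemma basis_of_subset:
  assumes "vspace V" "basis_of V B" shows "B \<subseteq> vcarrier V"
proof -
  interpret vector_space "vscale V" using assms by (simp add: vspace_def)
  show ?thesis using span_superset assms(2) by (auto simp: basis_of_def)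
qed

lemma dual_coordinate_expansion:
  assumes V: "vspace V" and B: "basis_of V B" "finite B" and w: "w \<in> vcarrier (dual V)"
    and x: "x \<in> vcarrier V"
  shows "w x = (\<Sum>v\<in>B. w v * coordinate V B v x)"
proof -
  have B': "v \<in> B \<Longrightarrow> v \<in> vcarrier V" for v using basis_of_subset[OF V B(1)] by auto
  have "w x = w (\<Sum>v\<in>B. vscale V (coordinate V B v x) v)"
    using coordinate_expansion[OF V B x] by simp
  also have "\<dots> = (\<Sum>v\<in>B. w (vscale V (coordinate V B v x) v))"
    using B' by (intro dual_sum[OF V w] vspace_closed[OF V])
  finally show ?thesis using B' by (simp add: dual_scale[OF w] mult.commute)
qed

lemma fd_vspace_dual:
  assumes fd: "fd_vspace V" shows "fd_vspace (dual V)"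
proof -
  note V = fd_vspace[OF fd]
  obtain B where B: "basis_of V B" "finite B" using fd by (auto simp: fd_vspace_def)
  note D = vspace_dual[OF V]
  interpret vector_space "vscale (dual V)" using D by (simp add: vspace_def)
  let ?S = "coordinate V B ` B"
  have "span ?S \<subseteq> vcarrier (dual V)"
    using D coordinate_mem_dual[OF V B(1)] by (intro span_minimal) (auto simp: vspace_def)
  moreover have "w \<in> span ?S" if w: "w \<in> vcarrier (dual V)" for w
  proof -
    have "(\<Sum>v\<in>B. vscale (dual V) (w v) (coordinate V B v)) \<in> vcarrier (dual V)"
      by (intro carrier_sum[OF D] vspace_closed[OF D] coordinate_mem_dual[OF V B(1)])
    then have "w = (\<Sum>v\<in>B. vscale (dual V) (w v) (coordinate V B v))"
      using dual_coordinate_expansion[OF V B w]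
      by (intro dual_eqI[OF w]) (simp_all add: sum_fun_apply, simp add: dual_def)
    also have "\<dots> \<in> span ?S" by (intro span_sum span_scale span_base) auto
    finally show ?thesis .
  qed
  ultimately show ?thesis using B(2) by (intro fd_vspaceI[OF D, of ?S]) auto
qed

text \<open>The vector is \<open>u = \<Sum>\<^sub>v F(v\<^sup>*) v\<close>; expanding \<open>w\<close> in the dual basis shows that evaluation at
  \<open>u\<close> agrees with \<open>F\<close>.\<close>

lemma bidual_reflexive:
  assumes fd: "fd_vspace V" and F: "F \<in> vcarrier (dual (dual V))"
  obtains u where "u \<in> vcarrier V" "\<And>w. w \<in> vcarrier (dual V) \<Longrightarrow> F w = w u"
proof -
  note V = fd_vspace[OF fd]
  obtain B where B: "basis_of V B" "finite B" using fd by (auto simp: fd_vspace_def)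
  note D = vspace_dual[OF V]
  have B': "v \<in> B \<Longrightarrow> v \<in> vcarrier V" for v using basis_of_subset[OF V B(1)] by auto
  note mem = coordinate_mem_dual[OF V B(1)]
  let ?u = "\<Sum>v\<in>B. vscale V (F (coordinate V B v)) v"
  have u: "?u \<in> vcarrier V" using B' by (intro carrier_sum[OF V] vspace_closed[OF V])
  have "F w = w ?u" if w: "w \<in> vcarrier (dual V)" for w
  proof -
    have "(\<Sum>v\<in>B. vscale (dual V) (w v) (coordinate V B v)) \<in> vcarrier (dual V)"
      by (intro carrier_sum[OF D] vspace_closed[OF D] mem)
    then have "w = (\<Sum>v\<in>B. vscale (dual V) (w v) (coordinate V B v))"
      using dual_coordinate_expansion[OF V B w]
      by (intro dual_eqI[OF w]) (simp_all add: sum_fun_apply, simp add: dual_def)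
    then have "F w = (\<Sum>v\<in>B. F (vscale (dual V) (w v) (coordinate V B v)))"
      using dual_sum[OF D F, of B "\<lambda>v. vscale (dual V) (w v) (coordinate V B v)"] mem vspace_closed(3)[OF D]
      by metis
    also have "\<dots> = (\<Sum>v\<in>B. w v * F (coordinate V B v))" by (simp add: dual_scale[OF F mem])
    also have "\<dots> = w ?u"
      using B' by (subst dual_sum[OF V w]) (auto intro: vspace_closed[OF V] simp: dual_scale[OF w] mult.commute)
    finally show ?thesis .
  qed
  then show ?thesis using that[OF u] by blast
qed

section \<open>Tensors as operators\<close>

lemma dual_map_eval: "x \<in> vcarrier A \<Longrightarrow> dual_map A f \<phi> x = \<phi> (f x)"
  by (simp add: dual_map_def)

lemma dual_map_id: "\<phi> \<in> vcarrier (dual A) \<Longrightarrow> dual_map A id \<phi> = \<phi>"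
  by (auto simp: dual_map_def fun_eq_iff mem_dual)

lemma linmap_id: "linmap A A id"
  by (simp add: linmap_def)

lemma vspace_tensor:
  fixes A :: "('k::field, 'a::ab_group_add, 'z) vsp_scheme"
    and B :: "('k, 'b::ab_group_add, 'y) vsp_scheme"
  shows "vspace (tensor A B)"
proof -
  interpret vector_space "\<lambda>(c::'k) (t :: ('a \<Rightarrow> 'k) \<Rightarrow> ('b \<Rightarrow> 'k) \<Rightarrow> 'k) \<phi> \<psi>. c * t \<phi> \<psi>"
    by (rule vector_space_tensor2)
  show ?thesis by (simp add: vspace_def tensor_def vector_space_axioms subspace_span)
qed

lemma tensor_induct [consumes 1, case_names zero tens add scale]:
  fixes A :: "('k::field, 'a::ab_group_add, 'z) vsp_scheme"
    and B :: "('k, 'b::ab_group_add, 'y) vsp_scheme"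
  assumes t: "t \<in> vcarrier (tensor A B)"
    and "P 0" and tens: "\<And>x y. x \<in> vcarrier A \<Longrightarrow> y \<in> vcarrier B \<Longrightarrow> P (tens A B x y)"
    and add: "\<And>s t. P s \<Longrightarrow> P t \<Longrightarrow> P (s + t)"
    and scale: "\<And>c t. P t \<Longrightarrow> P (\<lambda>\<phi> \<psi>. c * t \<phi> \<psi>)"
  shows "P t"
proof -
  interpret vector_space "\<lambda>(c::'k) (t :: ('a \<Rightarrow> 'k) \<Rightarrow> ('b \<Rightarrow> 'k) \<Rightarrow> 'k) \<phi> \<psi>. c * t \<phi> \<psi>"
    by (rule vector_space_tensor2)
  have "subspace (Collect P)" using assms(2-) by (auto simp: subspace_def)
  moreover have "t \<in> span {tens A B x y | x y. x \<in> vcarrier A \<and> y \<in> vcarrier B}"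
    using t by (simp add: tensor_def)
  ultimately show ?thesis using tens by (subst mem_Collect_eq[symmetric], elim span_induct) auto
qed

lemma tensor_off_dual:
  assumes "t \<in> vcarrier (tensor A B)" "\<not> (\<phi> \<in> vcarrier (dual A) \<and> \<psi> \<in> vcarrier (dual B))"
  shows "t \<phi> \<psi> = 0"
  using assms(1) by (induction rule: tensor_induct) (use assms(2) in \<open>auto simp: tens_def\<close>)

lemma flip_mem_tensor:
  fixes A :: "('k::field, 'a::ab_group_add, 'z) vsp_scheme"
  assumes "t \<in> vcarrier (tensor A A)" shows "flip t \<in> vcarrier (tensor A A)"
  using assms
proof (induction rule: tensor_induct)
  case zero
  have "flip 0 = (0 :: ('a \<Rightarrow> 'k) \<Rightarrow> ('a \<Rightarrow> 'k) \<Rightarrow> 'k)" by (simp add: flip_def fun_eq_iff)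
  then show ?case using vspace_closed(1)[OF vspace_tensor] by metis
next
  case (tens x y)
  then show ?case using bilinmap_tens[of A A] by (simp add: flip_tens bilinmap_def linmap_def)
next
  case (add s t)
  have "flip (s + t) = flip s + flip t" by (simp add: flip_def fun_eq_iff)
  then show ?case using add vspace_closed(2)[OF vspace_tensor] by metis
next
  case (scale c t)
  have "flip (\<lambda>\<phi> \<psi>. c * t \<phi> \<psi>) = vscale (tensor A A) c (flip t)" by (simp add: flip_def tensor_def fun_eq_iff)
  then show ?case using scale vspace_closed(3)[OF vspace_tensor] by metis
qed

lemma tensor_map_mem_tensor:
  assumes A: "vspace A" "linmap A A f" "linmap A A g" and t: "t \<in> vcarrier (tensor A A)"
  shows "tensor_map A f g t \<in> vcarrier (tensor A A)"
  using t
proof (induction rule: tensor_induct)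
  case zero
  have "tensor_map A f g 0 = 0" by (simp add: tensor_map_def fun_eq_iff)
  then show ?case using vspace_closed(1)[OF vspace_tensor] by metis
next
  case (tens x y)
  then show ?case using bilinmap_tens[of A A] assms
    by (simp add: tensor_map_tens bilinmap_def linmap_def)
next
  case (add s t)
  have "tensor_map A f g (s + t) = tensor_map A f g s + tensor_map A f g t"
    by (simp add: tensor_map_def fun_eq_iff)
  then show ?case using add vspace_closed(2)[OF vspace_tensor] by metis
next
  case (scale c t)
  have "tensor_map A f g (\<lambda>\<phi> \<psi>. c * t \<phi> \<psi>) = vscale (tensor A A) c (tensor_map A f g t)"
    by (simp add: tensor_map_def tensor_def fun_eq_iff)
  then show ?case using scale vspace_closed(3)[OF vspace_tensor] by metis
qed

lemma linmap_plus:
  assumes "vspace V" "linmap U V f" "linmap U V g" shows "linmap U V (\<lambda>x. f x + g x)"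
proof -
  interpret vector_space "vscale V" using assms by (simp add: vspace_def)
  show ?thesis using assms by (auto simp: linmap_def scale_right_distrib algebra_simps intro: vspace_closed)
qed

lemma linmap_scale:
  assumes "vspace V" "linmap U V f" shows "linmap U V (\<lambda>x. vscale V c (f x))"
proof -
  interpret vector_space "vscale V" using assms by (simp add: vspace_def)
  show ?thesis using assms by (auto simp: linmap_def scale_right_distrib mult.commute intro: vspace_closed)
qed

text \<open>An elementary tensor \<open>x \<otimes> y\<close> corresponds to \<open>\<psi> \<mapsto> \<psi>(y) x\<close>, and the correspondence is
  linear in the tensor.\<close>

lemma tensor_operator:
  assumes A: "vspace A" and r: "r \<in> vcarrier (tensor A A)"
  shows "\<exists>R. linmap (dual A) A R \<and>
    (\<forall>\<phi>\<in>vcarrier (dual A). \<forall>\<psi>\<in>vcarrier (dual A). r \<phi> \<psi> = \<phi> (R \<psi>))"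
  using r
proof (induction rule: tensor_induct)
  interpret vector_space "vscale A" using A by (simp add: vspace_def)
  {
    case zero
    show ?case using vspace_closed(1)[OF A]
      by (intro exI[of _ "\<lambda>_. 0"]) (auto simp: linmap_def dual_zero[OF A])
  next
    case (tens x y)
    have "linmap (dual A) A (\<lambda>\<psi>. vscale A (\<psi> y) x)"
      using tens vspace_closed(3)[OF A] by (auto simp: linmap_def scale_left_distrib dual_def)
    then show ?case using tens
      by (intro exI[of _ "\<lambda>\<psi>. vscale A (\<psi> y) x"]) (auto simp: tens_def dual_scale mult.commute)
  next
    case (add s t)
    then obtain R S where R: "linmap (dual A) A R" "linmap (dual A) A S"
      "\<forall>\<phi>\<in>vcarrier (dual A). \<forall>\<psi>\<in>vcarrier (dual A). s \<phi> \<psi> = \<phi> (R \<psi>)"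
      "\<forall>\<phi>\<in>vcarrier (dual A). \<forall>\<psi>\<in>vcarrier (dual A). t \<phi> \<psi> = \<phi> (S \<psi>)" by blast
    then show ?case
      by (intro exI[of _ "\<lambda>\<psi>. R \<psi> + S \<psi>"] conjI linmap_plus[OF A])
        (auto simp: dual_add linmap_def)
  next
    case (scale c t)
    then obtain R where R: "linmap (dual A) A R"
      "\<forall>\<phi>\<in>vcarrier (dual A). \<forall>\<psi>\<in>vcarrier (dual A). t \<phi> \<psi> = \<phi> (R \<psi>)" by blast
    then show ?case
      by (intro exI[of _ "\<lambda>\<psi>. vscale A c (R \<psi>)"] conjI linmap_scale[OF A])
        (auto simp: dual_scale linmap_def)
  }
qed

section \<open>Relative Poisson algebras and dual representations\<close>

locale rp_algebra =
  fixes A :: "('k::field, 'a::ab_group_add, 'z) rpa_scheme"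
  assumes rpa: "relative_poisson_algebra A"
begin

lemma fd: "fd_vspace A" using rpa by (simp add: relative_poisson_algebra_def)

lemma vs: "vspace A" using fd by (rule fd_vspace)

lemma bilinmap_mul: "bilinmap A A A (mul A)"
  using rpa by (simp add: relative_poisson_algebra_def comm_assoc_algebra_def)

lemma bilinmap_brk: "bilinmap A A A (brk A)"
  using rpa by (simp add: relative_poisson_algebra_def lie_algebra_def)

lemma linmap_mul: "x \<in> vcarrier A \<Longrightarrow> linmap A A (mul A x)"
  using bilinmap_mul by (simp add: bilinmap_def)

lemma linmap_brk: "x \<in> vcarrier A \<Longrightarrow> linmap A A (brk A x)"
  using bilinmap_brk by (simp add: bilinmap_def)

lemma linmap_der: "linmap A A (der A)"
  using rpa by (simp add: relative_poisson_algebra_def derivation_def)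

lemma closed [simp]:
  "0 \<in> vcarrier A"
  "x \<in> vcarrier A \<Longrightarrow> y \<in> vcarrier A \<Longrightarrow> x + y \<in> vcarrier A"
  "x \<in> vcarrier A \<Longrightarrow> y \<in> vcarrier A \<Longrightarrow> x - y \<in> vcarrier A"
  "x \<in> vcarrier A \<Longrightarrow> - x \<in> vcarrier A"
  "x \<in> vcarrier A \<Longrightarrow> vscale A c x \<in> vcarrier A"
  "x \<in> vcarrier A \<Longrightarrow> y \<in> vcarrier A \<Longrightarrow> mul A x y \<in> vcarrier A"
  "x \<in> vcarrier A \<Longrightarrow> y \<in> vcarrier A \<Longrightarrow> brk A x y \<in> vcarrier A"
  "x \<in> vcarrier A \<Longrightarrow> der A x \<in> vcarrier A"
  using vspace_closed[OF vs] carrier_diff[OF vs] carrier_uminus[OF vs]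
    linmap_mul linmap_brk linmap_der
  by (simp_all add: linmap_def)

lemma mul_comm: "x \<in> vcarrier A \<Longrightarrow> y \<in> vcarrier A \<Longrightarrow> mul A x y = mul A y x"
  using rpa unfolding relative_poisson_algebra_def comm_assoc_algebra_def by blast

lemma mul_assoc:
  "x \<in> vcarrier A \<Longrightarrow> y \<in> vcarrier A \<Longrightarrow> z \<in> vcarrier A \<Longrightarrow> mul A (mul A x y) z = mul A x (mul A y z)"
  using rpa unfolding relative_poisson_algebra_def comm_assoc_algebra_def by blast

lemma mul_left_comm:
  "x \<in> vcarrier A \<Longrightarrow> y \<in> vcarrier A \<Longrightarrow> z \<in> vcarrier A \<Longrightarrow> mul A x (mul A y z) = mul A y (mul A x z)"
  using mul_assoc[of x y z] mul_assoc[of y x z] mul_comm[of x y] by simp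

lemmas mul_ac = mul_comm mul_assoc mul_left_comm

lemma mul_add:
  "x \<in> vcarrier A \<Longrightarrow> y \<in> vcarrier A \<Longrightarrow> z \<in> vcarrier A \<Longrightarrow> mul A (x + y) z = mul A x z + mul A y z"
  "x \<in> vcarrier A \<Longrightarrow> y \<in> vcarrier A \<Longrightarrow> z \<in> vcarrier A \<Longrightarrow> mul A z (x + y) = mul A z x + mul A z y"
  using bilinmap_mul by (simp_all add: bilinmap_def linmap_def)

lemma brk_add:
  "x \<in> vcarrier A \<Longrightarrow> y \<in> vcarrier A \<Longrightarrow> z \<in> vcarrier A \<Longrightarrow> brk A (x + y) z = brk A x z + brk A y z"
  "x \<in> vcarrier A \<Longrightarrow> y \<in> vcarrier A \<Longrightarrow> z \<in> vcarrier A \<Longrightarrow> brk A z (x + y) = brk A z x + brk A z y"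
  using bilinmap_brk by (simp_all add: bilinmap_def linmap_def)

lemma mul_scale:
  "x \<in> vcarrier A \<Longrightarrow> y \<in> vcarrier A \<Longrightarrow> mul A (vscale A c x) y = vscale A c (mul A x y)"
  "x \<in> vcarrier A \<Longrightarrow> y \<in> vcarrier A \<Longrightarrow> mul A x (vscale A c y) = vscale A c (mul A x y)"
  using bilinmap_mul by (simp_all add: bilinmap_def linmap_def)

lemma brk_scale:
  "x \<in> vcarrier A \<Longrightarrow> y \<in> vcarrier A \<Longrightarrow> brk A (vscale A c x) y = vscale A c (brk A x y)"
  "x \<in> vcarrier A \<Longrightarrow> y \<in> vcarrier A \<Longrightarrow> brk A x (vscale A c y) = vscale A c (brk A x y)"
  using bilinmap_brk by (simp_all add: bilinmap_def linmap_def)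

lemma brk_self: "x \<in> vcarrier A \<Longrightarrow> brk A x x = 0"
  using rpa by (simp add: relative_poisson_algebra_def lie_algebra_def)

lemma brk_anti: "x \<in> vcarrier A \<Longrightarrow> y \<in> vcarrier A \<Longrightarrow> brk A x y = - brk A y x"
  using brk_self[of "x + y"] brk_self[of x] brk_self[of y]
  by (simp add: brk_add eq_neg_iff_add_eq_0 add.commute)

lemma brk_uminus: "x \<in> vcarrier A \<Longrightarrow> y \<in> vcarrier A \<Longrightarrow> brk A x (- y) = - brk A x y"
  using linmap_uminus[OF vs linmap_brk] by blast

lemma mul_uminus: "x \<in> vcarrier A \<Longrightarrow> y \<in> vcarrier A \<Longrightarrow> mul A x (- y) = - mul A x y"
  using linmap_uminus[OF vs linmap_mul] by blast

lemma jacobi: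
  "x \<in> vcarrier A \<Longrightarrow> y \<in> vcarrier A \<Longrightarrow> z \<in> vcarrier A \<Longrightarrow>
    brk A x (brk A y z) + brk A y (brk A z x) + brk A z (brk A x y) = 0"
  using rpa by (simp add: relative_poisson_algebra_def lie_algebra_def)

text \<open>The Jacobi identity as the statement that \<open>ad\<close> is a representation.\<close>

lemma jacobi_derivation:
  assumes "x \<in> vcarrier A" "y \<in> vcarrier A" "z \<in> vcarrier A"
  shows "brk A (brk A x y) z = brk A x (brk A y z) - brk A y (brk A x z)"
proof -
  have "brk A y (brk A z x) = - brk A y (brk A x z)"
    using assms by (subst brk_anti[of z x]) (simp_all add: brk_uminus)
  moreover have "brk A (brk A x y) z = - brk A z (brk A x y)"
    using assms by (intro brk_anti) simp_all
  moreover from this have "brk A x (brk A y z) - brk A y (brk A x z) = - brk A z (brk A x y)"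
    using jacobi[OF assms] \<open>brk A y (brk A z x) = - brk A y (brk A x z)\<close>
    by (simp add: eq_neg_iff_add_eq_0)
  ultimately show ?thesis by simp
qed

lemma leibniz:
  "x \<in> vcarrier A \<Longrightarrow> y \<in> vcarrier A \<Longrightarrow> z \<in> vcarrier A \<Longrightarrow>
    brk A z (mul A x y) = mul A (brk A z x) y + mul A x (brk A z y) + mul A (mul A x y) (der A z)"
  using rpa by (simp add: relative_poisson_algebra_def)

lemma der_add: "x \<in> vcarrier A \<Longrightarrow> y \<in> vcarrier A \<Longrightarrow> der A (x + y) = der A x + der A y"
  using linmap_der by (simp add: linmap_def)

lemma der_scale: "x \<in> vcarrier A \<Longrightarrow> der A (vscale A c x) = vscale A c (der A x)"
  using linmap_der by (simp add: linmap_def)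

lemma der_mul:
  "x \<in> vcarrier A \<Longrightarrow> y \<in> vcarrier A \<Longrightarrow> der A (mul A x y) = mul A (der A x) y + mul A x (der A y)"
  using rpa by (simp add: relative_poisson_algebra_def derivation_def)

lemma der_brk:
  "x \<in> vcarrier A \<Longrightarrow> y \<in> vcarrier A \<Longrightarrow> der A (brk A x y) = brk A (der A x) y + brk A x (der A y)"
  using rpa by (simp add: relative_poisson_algebra_def derivation_def)

text \<open>The laws of the algebra are needed below under a functional, in the shapes that the
  evaluation of the coalgebra axioms produces.\<close>

lemma functional_jacobi:
  assumes "\<phi> \<in> vcarrier (dual A)" "x \<in> vcarrier A" "y \<in> vcarrier A" "z \<in> vcarrier A"
  shows "\<phi> (brk A (brk A x y) z) - \<phi> (brk A (brk A x z) y) = \<phi> (brk A x (brk A y z))"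
  using assms
  by (simp add: jacobi_derivation[of x y z] brk_anti[of "brk A x z" y] dual_diff[OF vs] dual_uminus[OF vs])

lemma functional_leibniz:
  assumes "\<phi> \<in> vcarrier (dual A)" "x \<in> vcarrier A" "y \<in> vcarrier A" "z \<in> vcarrier A"
  shows "\<phi> (brk A z (mul A x y)) = \<phi> (mul A (brk A z x) y) + \<phi> (mul A x (brk A z y)) + \<phi> (mul A (mul A x y) (der A z))"
  using assms by (simp add: leibniz dual_add)

lemma functional_brk_anti:
  assumes "\<phi> \<in> vcarrier (dual A)" "x \<in> vcarrier A" "y \<in> vcarrier A"
  shows "\<phi> (brk A x y) = - \<phi> (brk A y x)"
  using assms brk_anti[of x y] by (simp add: dual_uminus[OF vs])

lemma functional_mul_brk_anti:
  assumes "\<phi> \<in> vcarrier (dual A)" "x \<in> vcarrier A" "y \<in> vcarrier A" "z \<in> vcarrier A"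
  shows "\<phi> (mul A z (brk A x y)) = - \<phi> (mul A z (brk A y x))"
  using assms brk_anti[of x y] by (simp add: dual_uminus[OF vs] mul_uminus)

lemma functional_leibniz_right:
  assumes "\<phi> \<in> vcarrier (dual A)" "x \<in> vcarrier A" "y \<in> vcarrier A" "z \<in> vcarrier A"
  shows "\<phi> (brk A (mul A x y) z) = \<phi> (mul A y (brk A x z)) + \<phi> (mul A x (brk A y z)) - \<phi> (mul A (mul A x y) (der A z))"
proof -
  have "\<phi> (brk A (mul A x y) z) = - \<phi> (brk A z (mul A x y))"
    using assms by (intro functional_brk_anti) simp_all
  moreover have "\<phi> (mul A (brk A z x) y) = - \<phi> (mul A y (brk A x z))"
    using assms functional_mul_brk_anti[of \<phi> z x y] mul_comm[of "brk A z x" y] by simp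
  moreover have "\<phi> (mul A x (brk A z y)) = - \<phi> (mul A x (brk A y z))"
    using assms by (intro functional_mul_brk_anti) simp_all
  ultimately show ?thesis using functional_leibniz[OF assms] by simp
qed

end

text \<open>Both signs occur: the dual of \<open>\<rho>\<close> carries the sign of \<open>dual_action\<close>, that of \<open>\<mu>\<close> does not.\<close>

lemma bilinmap_dual_action:
  assumes V: "vspace V" and \<mu>: "bilinmap A V V \<mu>"
  shows "bilinmap A (dual V) (dual V) (dual_action V \<mu>)" (is ?d)
    and "bilinmap A (dual V) (dual V) (- dual_action V \<mu>)" (is ?m)
proof -
  have \<mu>': "x \<in> vcarrier A \<Longrightarrow> v \<in> vcarrier V \<Longrightarrow> \<mu> x v \<in> vcarrier V"
    "x \<in> vcarrier A \<Longrightarrow> v \<in> vcarrier V \<Longrightarrow> w \<in> vcarrier V \<Longrightarrow> \<mu> x (v + w) = \<mu> x v + \<mu> x w"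
    "x \<in> vcarrier A \<Longrightarrow> v \<in> vcarrier V \<Longrightarrow> \<mu> x (vscale V k v) = vscale V k (\<mu> x v)"
    "x \<in> vcarrier A \<Longrightarrow> y \<in> vcarrier A \<Longrightarrow> v \<in> vcarrier V \<Longrightarrow> \<mu> (x + y) v = \<mu> x v + \<mu> y v"
    "x \<in> vcarrier A \<Longrightarrow> v \<in> vcarrier V \<Longrightarrow> \<mu> (vscale A k x) v = vscale V k (\<mu> x v)"
    for x y v w k
    using \<mu> by (auto simp: bilinmap_def linmap_def)
  have s: "vscale (dual V) = (\<lambda>c \<phi> x. c * \<phi> x)" by (simp add: dual_def)
  have mem: "(\<lambda>v. if v \<in> vcarrier V then u (\<mu> x v) else 0) \<in> vcarrier (dual V)"
    if "x \<in> vcarrier A" "u \<in> vcarrier (dual V)" for x u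
    by (intro mem_dual_guarded[OF V]) (use that in \<open>simp_all add: \<mu>' dual_add dual_scale\<close>)

  have act: "dual_action V \<mu> x u = - (\<lambda>v. if v \<in> vcarrier V then u (\<mu> x v) else 0)" for x u
    by (auto simp: dual_action_def fun_eq_iff)
  show ?m
    using mem by (auto simp: bilinmap_def linmap_def act s fun_eq_iff \<mu>' dual_add dual_scale)
  show ?d
    using carrier_uminus[OF vspace_dual[OF V] mem]
    by (auto simp: bilinmap_def linmap_def act s fun_eq_iff \<mu>' dual_add dual_scale)
qed

lemma linmap_dual_map:
  assumes "vspace V" "linmap V V f" shows "linmap (dual V) (dual V) (dual_map V f)"
  using dual_map_mem[OF assms] unfolding linmap_def
  by (auto simp: dual_map_def dual_def fun_eq_iff)

locale rp_compatible = rp_algebra A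
  for A :: "('k::field, 'a::ab_group_add, 'z) rpa_scheme" +
  fixes V :: "('k, 'v::ab_group_add, 'y) vsp_scheme" and \<mu> \<rho> :: "'a \<Rightarrow> 'v \<Rightarrow> 'v"
  assumes compatible: "compatible_structure A V \<mu> \<rho>"
begin

lemma fdV: "fd_vspace V" using compatible by (simp add: compatible_structure_def)

lemma vsV: "vspace V" using fdV by (rule fd_vspace)

lemma bilinmap_actions: "bilinmap A V V \<mu>" "bilinmap A V V \<rho>"
  using compatible by (simp_all add: compatible_structure_def)

lemma closedV [simp]:
  "0 \<in> vcarrier V"
  "u \<in> vcarrier V \<Longrightarrow> v \<in> vcarrier V \<Longrightarrow> u + v \<in> vcarrier V"
  "u \<in> vcarrier V \<Longrightarrow> v \<in> vcarrier V \<Longrightarrow> u - v \<in> vcarrier V"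
  "u \<in> vcarrier V \<Longrightarrow> - u \<in> vcarrier V"
  "u \<in> vcarrier V \<Longrightarrow> vscale V c u \<in> vcarrier V"
  "x \<in> vcarrier A \<Longrightarrow> u \<in> vcarrier V \<Longrightarrow> \<mu> x u \<in> vcarrier V"
  "x \<in> vcarrier A \<Longrightarrow> u \<in> vcarrier V \<Longrightarrow> \<rho> x u \<in> vcarrier V"
  using vspace_closed[OF vsV] carrier_diff[OF vsV] carrier_uminus[OF vsV] bilinmap_actions
  by (simp_all add: bilinmap_def linmap_def)

lemma action_add:
  "x \<in> vcarrier A \<Longrightarrow> y \<in> vcarrier A \<Longrightarrow> v \<in> vcarrier V \<Longrightarrow> \<mu> (x + y) v = \<mu> x v + \<mu> y v"
  "x \<in> vcarrier A \<Longrightarrow> u \<in> vcarrier V \<Longrightarrow> v \<in> vcarrier V \<Longrightarrow> \<mu> x (u + v) = \<mu> x u + \<mu> x v"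
  "x \<in> vcarrier A \<Longrightarrow> y \<in> vcarrier A \<Longrightarrow> v \<in> vcarrier V \<Longrightarrow> \<rho> (x + y) v = \<rho> x v + \<rho> y v"
  "x \<in> vcarrier A \<Longrightarrow> u \<in> vcarrier V \<Longrightarrow> v \<in> vcarrier V \<Longrightarrow> \<rho> x (u + v) = \<rho> x u + \<rho> x v"
  using bilinmap_actions by (simp_all add: bilinmap_def linmap_def)

lemma action_scale:
  "x \<in> vcarrier A \<Longrightarrow> v \<in> vcarrier V \<Longrightarrow> \<mu> (vscale A c x) v = vscale V c (\<mu> x v)"
  "x \<in> vcarrier A \<Longrightarrow> v \<in> vcarrier V \<Longrightarrow> \<mu> x (vscale V c v) = vscale V c (\<mu> x v)"
  "x \<in> vcarrier A \<Longrightarrow> v \<in> vcarrier V \<Longrightarrow> \<rho> (vscale A c x) v = vscale V c (\<rho> x v)"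
  "x \<in> vcarrier A \<Longrightarrow> v \<in> vcarrier V \<Longrightarrow> \<rho> x (vscale V c v) = vscale V c (\<rho> x v)"
  using bilinmap_actions by (simp_all add: bilinmap_def linmap_def)

lemma action_diff:
  "x \<in> vcarrier A \<Longrightarrow> u \<in> vcarrier V \<Longrightarrow> v \<in> vcarrier V \<Longrightarrow> \<mu> x (u - v) = \<mu> x u - \<mu> x v"
  "x \<in> vcarrier A \<Longrightarrow> u \<in> vcarrier V \<Longrightarrow> v \<in> vcarrier V \<Longrightarrow> \<rho> x (u - v) = \<rho> x u - \<rho> x v"
  using bilinmap_actions linmap_diff[OF vsV] unfolding bilinmap_def by blast+

lemma action_mul:
  "x \<in> vcarrier A \<Longrightarrow> y \<in> vcarrier A \<Longrightarrow> v \<in> vcarrier V \<Longrightarrow> \<mu> (mul A x y) v = \<mu> x (\<mu> y v)"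
  using compatible by (simp add: compatible_structure_def)

lemma action_mul_comm:
  "x \<in> vcarrier A \<Longrightarrow> y \<in> vcarrier A \<Longrightarrow> v \<in> vcarrier V \<Longrightarrow> \<mu> x (\<mu> y v) = \<mu> y (\<mu> x v)"
  using action_mul[of x y v] action_mul[of y x v] mul_comm[of x y] by simp

lemma action_brk:
  "x \<in> vcarrier A \<Longrightarrow> y \<in> vcarrier A \<Longrightarrow> v \<in> vcarrier V \<Longrightarrow> \<rho> (brk A x y) v = \<rho> x (\<rho> y v) - \<rho> y (\<rho> x v)"
  using compatible by (simp add: compatible_structure_def)

lemma action_mixed:
  "x \<in> vcarrier A \<Longrightarrow> y \<in> vcarrier A \<Longrightarrow> v \<in> vcarrier V \<Longrightarrow>
    \<mu> (brk A x y) v = \<mu> x (\<rho> y v) - \<rho> y (\<mu> x v) + \<mu> (mul A x (der A y)) v"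
  using compatible by (simp add: compatible_structure_def algebra_simps)

text \<open>The same law with the bracket reversed, as it appears in the Leibniz rule of the
  semi-direct product.\<close>

lemma action_mixed':
  assumes "x \<in> vcarrier A" "y \<in> vcarrier A" "v \<in> vcarrier V"
  shows "\<mu> (brk A y x) v = \<rho> y (\<mu> x v) - \<mu> x (\<rho> y v) - \<mu> (mul A x (der A y)) v"
proof -
  have "\<mu> (- brk A x y) v = - \<mu> (brk A x y) v"
    using linmap_uminus[OF vs, of V "\<lambda>a. \<mu> a v"] bilinmap_actions(1) assms by (simp add: bilinmap_def)
  then show ?thesis using action_mixed[OF assms] brk_anti[OF assms(2,1)] by (simp add: algebra_simps)
qed

text \<open>Transposition reverses the order of composition.  For \<open>\<mu>\<close> this is harmless because the
  product is commutative, for \<open>\<rho>\<close> the sign of \<open>dual_action\<close> restores the order, and the mixed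
  law is symmetric under the two changes together.\<close>

lemma compatible_dual:
  "compatible_structure A (dual V) (- dual_action V \<mu>) (dual_action V \<rho>)"
  unfolding compatible_structure_def
proof (intro conjI ballI)
  show "fd_vspace (dual V)" by (rule fd_vspace_dual[OF fdV])
  show "bilinmap A (dual V) (dual V) (- dual_action V \<mu>)" "bilinmap A (dual V) (dual V) (dual_action V \<rho>)"
    using bilinmap_dual_action[OF vsV] bilinmap_actions by auto
next
  fix x y u assume xy: "x \<in> vcarrier A" "y \<in> vcarrier A" and u: "u \<in> vcarrier (dual V)"
  note u' = dual_diff[OF vsV u] dual_add[OF u]
  show "(- dual_action V \<mu>) (mul A x y) u = (- dual_action V \<mu>) x ((- dual_action V \<mu>) y u)"
    using xy by (intro ext) (auto simp: dual_action_def action_mul action_mul_comm)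
  show "dual_action V \<rho> (brk A x y) u
      = dual_action V \<rho> x (dual_action V \<rho> y u) - dual_action V \<rho> y (dual_action V \<rho> x u)"
    using xy by (intro ext) (auto simp: dual_action_def action_brk u')
  show "dual_action V \<rho> y ((- dual_action V \<mu>) x u) - (- dual_action V \<mu>) x (dual_action V \<rho> y u)
      + (- dual_action V \<mu>) (brk A x y) u - (- dual_action V \<mu>) (mul A x (der A y)) u = 0"
    using xy by (intro ext) (auto simp: dual_action_def action_mixed u')
qed

text \<open>Each condition on \<open>V\<^sup>*\<close> is an identity \<open>u(a) = u(b)\<close> for all functionals \<open>u\<close> and vectors
  \<open>v\<close>, with \<open>a\<close> and \<open>b\<close> depending on \<open>v\<close>; separation of points turns it into \<open>a = b\<close> on \<open>V\<close>.\<close>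

lemma dually_represents_on_iff:
  "dually_represents_on A V \<mu> \<rho> \<beta> \<longleftrightarrow> linmap V V \<beta> \<and>
    (\<forall>x\<in>vcarrier A. \<forall>v\<in>vcarrier V. \<beta> (\<mu> x v) = \<mu> x (\<beta> v) - \<mu> (der A x) v) \<and>
    (\<forall>x\<in>vcarrier A. \<forall>v\<in>vcarrier V. \<beta> (\<rho> x v) = \<rho> x (\<beta> v) - \<rho> (der A x) v) \<and>
    (\<forall>x\<in>vcarrier A. \<forall>y\<in>vcarrier A. \<forall>v\<in>vcarrier V.
      \<beta> (\<mu> (mul A x y) v) = \<rho> (mul A x y) v - \<rho> x (\<mu> y v) - \<rho> y (\<mu> x v))"
proof (cases "linmap V V \<beta>")
  case True
  then have \<beta> [simp]: "v \<in> vcarrier V \<Longrightarrow> \<beta> v \<in> vcarrier V" for v by (simp add: linmap_def)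
  let ?m = "- dual_action V \<mu>" and ?r = "dual_action V \<rho>" and ?b = "dual_map V \<beta>"
  have sep: "(\<forall>u\<in>vcarrier (dual V). u v = u w) \<longleftrightarrow> v = w"
    if "v \<in> vcarrier V" "w \<in> vcarrier V" for v w
    using dual_separates[OF vsV that] by auto
  have \<mu>: "(\<forall>u\<in>vcarrier (dual V). ?b (?m x u) = ?m (der A x) u + ?m x (?b u)) \<longleftrightarrow>
      (\<forall>v\<in>vcarrier V. \<beta> (\<mu> x v) = \<mu> x (\<beta> v) - \<mu> (der A x) v)" if x: "x \<in> vcarrier A" for x
  proof -
    have "(\<forall>u\<in>vcarrier (dual V). ?b (?m x u) = ?m (der A x) u + ?m x (?b u)) \<longleftrightarrow>
        (\<forall>u\<in>vcarrier (dual V). \<forall>v\<in>vcarrier V. u (\<mu> x (\<beta> v)) = u (\<mu> (der A x) v) + u (\<beta> (\<mu> x v)))"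
      using x by (intro ball_cong refl) (auto simp: fun_eq_iff dual_action_def dual_map_def)
    also have "\<dots> \<longleftrightarrow> (\<forall>v\<in>vcarrier V. \<forall>u\<in>vcarrier (dual V). u (\<beta> (\<mu> x v)) = u (\<mu> x (\<beta> v) - \<mu> (der A x) v))"
      using x by (auto simp: dual_diff[OF vsV] algebra_simps)
    finally show ?thesis using x by (simp add: sep)
  qed
  have \<rho>: "(\<forall>u\<in>vcarrier (dual V). ?b (?r x u) = ?r (der A x) u + ?r x (?b u)) \<longleftrightarrow>
      (\<forall>v\<in>vcarrier V. \<beta> (\<rho> x v) = \<rho> x (\<beta> v) - \<rho> (der A x) v)" if x: "x \<in> vcarrier A" for x
  proof -
    have "(\<forall>u\<in>vcarrier (dual V). ?b (?r x u) = ?r (der A x) u + ?r x (?b u)) \<longleftrightarrow>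
        (\<forall>u\<in>vcarrier (dual V). \<forall>v\<in>vcarrier V. - u (\<rho> x (\<beta> v)) = - u (\<rho> (der A x) v) - u (\<beta> (\<rho> x v)))"
      using x by (intro ball_cong refl) (auto simp: fun_eq_iff dual_action_def dual_map_def)
    also have "\<dots> \<longleftrightarrow> (\<forall>v\<in>vcarrier V. \<forall>u\<in>vcarrier (dual V). u (\<beta> (\<rho> x v)) = u (\<rho> x (\<beta> v) - \<rho> (der A x) v))"
      using x by (auto simp: dual_diff[OF vsV] algebra_simps)
    finally show ?thesis using x by (simp add: sep)
  qed
  have mixed: "(\<forall>u\<in>vcarrier (dual V). ?r (mul A x y) u - ?m x (?r y u) - ?m y (?r x u) + ?m (mul A x y) (?b u) = 0) \<longleftrightarrow>
      (\<forall>v\<in>vcarrier V. \<beta> (\<mu> (mul A x y) v) = \<rho> (mul A x y) v - \<rho> x (\<mu> y v) - \<rho> y (\<mu> x v))"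
    if x: "x \<in> vcarrier A" "y \<in> vcarrier A" for x y
  proof -
    have "(\<forall>u\<in>vcarrier (dual V). ?r (mul A x y) u - ?m x (?r y u) - ?m y (?r x u) + ?m (mul A x y) (?b u) = 0) \<longleftrightarrow>
        (\<forall>u\<in>vcarrier (dual V). \<forall>v\<in>vcarrier V.
          - u (\<rho> (mul A x y) v) + u (\<rho> y (\<mu> x v)) + u (\<rho> x (\<mu> y v)) + u (\<beta> (\<mu> (mul A x y) v)) = 0)"
      using x by (intro ball_cong refl)
        (auto simp: fun_eq_iff dual_action_def dual_map_def eq_neg_iff_add_eq_0 algebra_simps)
    also have "\<dots> \<longleftrightarrow> (\<forall>v\<in>vcarrier V. \<forall>u\<in>vcarrier (dual V).
        u (\<beta> (\<mu> (mul A x y) v)) = u (\<rho> (mul A x y) v - \<rho> x (\<mu> y v) - \<rho> y (\<mu> x v)))"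
    proof -
      have e: "u (\<rho> (mul A x y) v - (\<rho> x (\<mu> y v) + \<rho> y (\<mu> x v)))
          = u (\<rho> (mul A x y) v) - (u (\<rho> x (\<mu> y v)) + u (\<rho> y (\<mu> x v)))"
        if "u \<in> vcarrier (dual V)" "v \<in> vcarrier V" for u v
        using that x by (simp only: dual_diff[OF vsV] dual_add closedV closed)
      show ?thesis by (auto simp: e algebra_simps)
    qed
    finally show ?thesis using x by (simp add: sep)
  qed
  have "dually_represents_on A V \<mu> \<rho> \<beta> \<longleftrightarrow>
      (\<forall>x\<in>vcarrier A. \<forall>u\<in>vcarrier (dual V). ?b (?m x u) = ?m (der A x) u + ?m x (?b u)) \<and>
      (\<forall>x\<in>vcarrier A. \<forall>u\<in>vcarrier (dual V). ?b (?r x u) = ?r (der A x) u + ?r x (?b u)) \<and>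
      (\<forall>x\<in>vcarrier A. \<forall>y\<in>vcarrier A. \<forall>u\<in>vcarrier (dual V).
        ?r (mul A x y) u - ?m x (?r y u) - ?m y (?r x u) + ?m (mul A x y) (?b u) = 0)"
    using True compatible_dual linmap_dual_map[OF vsV True]
    unfolding dually_represents_on_def rpa_rep_def by blast
  then show ?thesis using True by (simp only: \<mu> \<rho> mixed simp_thms cong: ball_cong)
qed (simp add: dually_represents_on_def)

end

text \<open>The adjoint structure.  It makes \<open>dually_represents\<close> the special case of
  \<open>dually_represents_on\<close> in which \<open>V = A\<close>.\<close>

lemma (in rp_algebra) compatible_adjoint: "compatible_structure A A (mul A) (brk A)"
  unfolding compatible_structure_def
proof (intro conjI ballI fd bilinmap_mul bilinmap_brk)
  fix x y v assume a: "x \<in> vcarrier A" "y \<in> vcarrier A" "v \<in> vcarrier A"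
  show "mul A (mul A x y) v = mul A x (mul A y v)" using a by (rule mul_assoc)
  show "brk A (brk A x y) v = brk A x (brk A y v) - brk A y (brk A x v)"
    using a by (rule jacobi_derivation)
  have "mul A (brk A x y) v = - mul A (brk A y x) v"
    using a brk_anti[of x y] mul_uminus[of v "brk A y x"] mul_comm[of v] by simp
  then show "brk A y (mul A x v) - mul A x (brk A y v) + mul A (brk A x y) v - mul A (mul A x (der A y)) v = 0"
    using a leibniz[of x v y] by (simp add: mul_ac)
qed

sublocale rp_algebra \<subseteq> adjoint: rp_compatible A A "mul A" "brk A"
  by unfold_locales (rule compatible_adjoint)

lemma (in rp_algebra) dually_represents_iff:
  "dually_represents A Q \<longleftrightarrow> linmap A A Q \<and>
    (\<forall>x\<in>vcarrier A. \<forall>z\<in>vcarrier A. Q (mul A x z) = mul A x (Q z) - mul A (der A x) z) \<and>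
    (\<forall>x\<in>vcarrier A. \<forall>z\<in>vcarrier A. Q (brk A x z) = brk A x (Q z) - brk A (der A x) z) \<and>
    (\<forall>x\<in>vcarrier A. \<forall>y\<in>vcarrier A. \<forall>z\<in>vcarrier A.
      Q (mul A (mul A x y) z) = brk A (mul A x y) z - brk A x (mul A y z) - brk A y (mul A x z))"
  using adjoint.dually_represents_on_iff
  unfolding dually_represents_on_def dually_represents_def .

section \<open>Semi-direct products\<close>

lemma vspace_prod:
  assumes V: "vspace V" and W: "vspace W"
    and S: "vcarrier S = vcarrier V \<times> vcarrier W"
      "vscale S = (\<lambda>c (x, u). (vscale V c x, vscale W c u))"
  shows "vspace S"
proof -
  interpret V: vector_space "vscale V" using V by (simp add: vspace_def)
  interpret W: vector_space "vscale W" using W by (simp add: vspace_def)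
  interpret S: vector_space "vscale S"
    by unfold_locales (auto simp: S V.scale_right_distrib V.scale_left_distrib
        W.scale_right_distrib W.scale_left_distrib)
  have "S.subspace (vcarrier S)"
    unfolding S.subspace_def using vspace_closed[OF V] vspace_closed[OF W]
    by (auto simp: S zero_prod_def)
  then show ?thesis by (simp add: vspace_def S.vector_space_axioms)
qed

lemma fd_vspace_prod:
  assumes V: "fd_vspace V" and W: "fd_vspace W"
    and S: "vcarrier S = vcarrier V \<times> vcarrier W"
      "vscale S = (\<lambda>c (x, u). (vscale V c x, vscale W c u))"
  shows "fd_vspace S"
proof -
  note vV = fd_vspace[OF V] and vW = fd_vspace[OF W]
  obtain B C where B: "finite B" "basis_of V B" and C: "finite C" "basis_of W C"
    using V W by (auto simp: fd_vspace_def)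
  have vS: "vspace S" by (rule vspace_prod[OF vV vW S])
  interpret S: vector_space "vscale S" using vS by (simp add: vspace_def)
  interpret V: vector_space "vscale V" using vV by (simp add: vspace_def)
  interpret W: vector_space "vscale W" using vW by (simp add: vspace_def)
  let ?G = "(\<lambda>x. (x, 0)) ` B \<union> (\<lambda>u. (0, u)) ` C"
  have "S.span ?G \<subseteq> vcarrier S"
    using basis_of_subset[OF vV B(2)] basis_of_subset[OF vW C(2)] vspace_closed(1)[OF vV] vspace_closed(1)[OF vW] vS
    by (intro S.span_minimal) (auto simp: S(1) vspace_def)
  moreover have "(x, u) \<in> S.span ?G" if x: "x \<in> vcarrier V" and u: "u \<in> vcarrier W" for x u
  proof -
    have "(x, 0) = (\<Sum>b\<in>B. vscale S (coordinate V B b x) (b, 0))"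
      using coordinate_expansion[OF vV B(2,1) x] by (intro prod_eqI) (simp_all add: fst_sum snd_sum S)
    also have "\<dots> \<in> S.span ?G" by (intro S.span_sum S.span_scale S.span_base) auto
    finally have 1: "(x, 0) \<in> S.span ?G" .
    have "(0, u) = (\<Sum>c\<in>C. vscale S (coordinate W C c u) (0, c))"
      using coordinate_expansion[OF vW C(2,1) u] by (intro prod_eqI) (simp_all add: fst_sum snd_sum S)
    also have "\<dots> \<in> S.span ?G" by (intro S.span_sum S.span_scale S.span_base) auto
    finally have 2: "(0, u) \<in> S.span ?G" .
    show ?thesis using S.span_add[OF 1 2] by simp
  qed
  ultimately show ?thesis using B(1) C(1) by (intro fd_vspaceI[OF vS, of ?G]) (auto simp: S(1))
qed

locale rp_representation = rp_compatible A V \<mu> \<rho>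
  for A :: "('k::field, 'a::ab_group_add, 'z) rpa_scheme"
    and V :: "('k, 'v::ab_group_add, 'y) vsp_scheme" and \<mu> \<rho> +
  fixes \<alpha> :: "'v \<Rightarrow> 'v"
  assumes rep: "rpa_rep A V \<mu> \<rho> \<alpha>"
begin

lemma linmap_alpha: "linmap V V \<alpha>" using rep by (simp add: rpa_rep_def)

lemma alpha_closed [simp]: "v \<in> vcarrier V \<Longrightarrow> \<alpha> v \<in> vcarrier V"
  using linmap_alpha by (simp add: linmap_def)

lemma alpha_linear:
  "u \<in> vcarrier V \<Longrightarrow> v \<in> vcarrier V \<Longrightarrow> \<alpha> (u + v) = \<alpha> u + \<alpha> v"
  "u \<in> vcarrier V \<Longrightarrow> v \<in> vcarrier V \<Longrightarrow> \<alpha> (u - v) = \<alpha> u - \<alpha> v"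
  "u \<in> vcarrier V \<Longrightarrow> \<alpha> (vscale V c u) = vscale V c (\<alpha> u)"
  using linmap_alpha linmap_diff[OF vsV linmap_alpha] by (simp_all add: linmap_def)

lemma alpha_mu: "x \<in> vcarrier A \<Longrightarrow> v \<in> vcarrier V \<Longrightarrow> \<alpha> (\<mu> x v) = \<mu> (der A x) v + \<mu> x (\<alpha> v)"
  using rep by (simp add: rpa_rep_def)

lemma alpha_rho: "x \<in> vcarrier A \<Longrightarrow> v \<in> vcarrier V \<Longrightarrow> \<alpha> (\<rho> x v) = \<rho> (der A x) v + \<rho> x (\<alpha> v)"
  using rep by (simp add: rpa_rep_def)

lemma rho_mul: "x \<in> vcarrier A \<Longrightarrow> y \<in> vcarrier A \<Longrightarrow> v \<in> vcarrier V \<Longrightarrow>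
    \<rho> (mul A x y) v = \<mu> x (\<rho> y v) + \<mu> y (\<rho> x v) - \<mu> (mul A x y) (\<alpha> v)"
  using rep by (simp add: rpa_rep_def algebra_simps)

text \<open>Each axiom restricts on \<open>A\<close> to the same axiom of \<open>A\<close>; its component in \<open>V\<close> is linear
  in the elements of \<open>V\<close>, and the coefficient of each of them is one of the conditions on a
  representation.\<close>

lemma relative_poisson_algebra_semidirect:
  "relative_poisson_algebra (semidirect A V \<mu> \<rho> \<alpha>)" (is "relative_poisson_algebra ?S")
proof -
  interpret V: vector_space "vscale V" using vsV by (simp add: vspace_def)
  note scale = V.scale_right_distrib V.scale_right_diff_distrib
  have S [simp]: "vcarrier ?S = vcarrier A \<times> vcarrier V"
    "vscale ?S = (\<lambda>c (x, u). (vscale A c x, vscale V c u))"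
    "mul ?S (x, u) (y, v) = (mul A x y, \<mu> x v + \<mu> y u)"
    "brk ?S (x, u) (y, v) = (brk A x y, \<rho> x v - \<rho> y u)"
    "der ?S (x, u) = (der A x, \<alpha> u)" for x u y v
    by (simp_all add: semidirect_def)
  have fdS: "fd_vspace ?S" by (rule fd_vspace_prod[OF fd fdV S(1,2)])
  have mul: "bilinmap ?S ?S ?S (mul ?S)"
    unfolding bilinmap_def linmap_def
    by (auto simp: mul_add mul_scale action_add action_scale scale)
  have brk: "bilinmap ?S ?S ?S (brk ?S)"
    unfolding bilinmap_def linmap_def
    by (auto simp: brk_add brk_scale action_add action_scale scale)
  have der: "linmap ?S ?S (der ?S)"
    unfolding linmap_def by (auto simp: der_add der_scale alpha_linear)
  have comm: "comm_assoc_algebra ?S (mul ?S)"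
    unfolding comm_assoc_algebra_def using mul
    by (auto simp: mul_ac action_add action_mul action_mul_comm algebra_simps)
  have lie: "lie_algebra ?S (brk ?S)"
    unfolding lie_algebra_def using brk
    by (auto simp: brk_self jacobi action_diff action_brk zero_prod_def)
  have dm: "derivation ?S (mul ?S) (der ?S)"
    unfolding derivation_def using der by (auto simp: der_mul alpha_linear alpha_mu algebra_simps)
  have db: "derivation ?S (brk ?S) (der ?S)"
    unfolding derivation_def using der by (auto simp: der_brk alpha_linear alpha_rho algebra_simps)
  have leib: "brk ?S z (mul ?S x y) = mul ?S (brk ?S z x) y + mul ?S x (brk ?S z y) + mul ?S (mul ?S x y) (der ?S z)"
    if "x \<in> vcarrier ?S" "y \<in> vcarrier ?S" "z \<in> vcarrier ?S" for x y z
    using that by (auto simp: leibniz action_add action_diff rho_mul action_mixed'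
        action_mul action_mul_comm algebra_simps)
  show ?thesis unfolding relative_poisson_algebra_def
    by (intro conjI ballI fdS comm lie dm db leib)
qed

end

section \<open>The Yang-Baxter equation in operator form\<close>

text \<open>The locale carries both \<open>r\<close> and \<open>R\<close>, although each determines the other: the
  Yang-Baxter equation is stated for \<open>r\<close>, all computations are done with \<open>R\<close>.\<close>

locale antisymmetric_operator = rp_algebra A
  for A :: "('k::field, 'a::ab_group_add, 'z) rpa_scheme" +
  fixes r :: "('k, 'a) tensor2" and R :: "('a \<Rightarrow> 'k) \<Rightarrow> 'a"
  assumes r_mem: "r \<in> vcarrier (tensor A A)"
    and linR: "linmap (dual A) A R"
    and r_eval: "\<phi> \<in> vcarrier (dual A) \<Longrightarrow> \<psi> \<in> vcarrier (dual A) \<Longrightarrow> r \<phi> \<psi> = \<phi> (R \<psi>)"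
    and skew: "\<phi> \<in> vcarrier (dual A) \<Longrightarrow> \<psi> \<in> vcarrier (dual A) \<Longrightarrow> \<phi> (R \<psi>) = - \<psi> (R \<phi>)"
begin

lemma R_closed [simp]: "\<phi> \<in> vcarrier (dual A) \<Longrightarrow> R \<phi> \<in> vcarrier A"
  using linR by (simp add: linmap_def)

lemma dual_map_closed [simp]:
  "linmap A A f \<Longrightarrow> \<phi> \<in> vcarrier (dual A) \<Longrightarrow> dual_map A f \<phi> \<in> vcarrier (dual A)"
  by (rule dual_map_mem[OF vs])

lemma r_eval_right:
  "\<phi> \<in> vcarrier (dual A) \<Longrightarrow> \<psi> \<in> vcarrier (dual A) \<Longrightarrow> r \<phi> \<psi> = - \<psi> (R \<phi>)"
  using r_eval skew by simp

text \<open>Contracting a slot of \<open>r\<close> with \<open>\<theta>\<close> leaves \<open>R\<theta>\<close> in the first factor and \<open>- R\<theta>\<close> in the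
  second.  In the product \<open>r\<^sub>1\<^sub>2 \<diamond> r\<^sub>2\<^sub>3\<close> there is one contraction of each kind, whence the sign.\<close>

lemma
  assumes m: "bilinmap A A A m" and d: "\<phi> \<in> vcarrier (dual A)" "\<psi> \<in> vcarrier (dual A)" "\<chi> \<in> vcarrier (dual A)"
  shows prod_12_13_eval: "prod_12_13 A m r \<phi> \<psi> \<chi> = \<phi> (m (R \<psi>) (R \<chi>))"
    and prod_12_23_eval: "prod_12_23 A m r \<phi> \<psi> \<chi> = - \<psi> (m (R \<phi>) (R \<chi>))"
    and prod_13_23_eval: "prod_13_23 A m r \<phi> \<psi> \<chi> = \<chi> (m (R \<phi>) (R \<psi>))"
proof -
  have m': "x \<in> vcarrier A \<Longrightarrow> y \<in> vcarrier A \<Longrightarrow> m x y \<in> vcarrier A"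
    "x \<in> vcarrier A \<Longrightarrow> y \<in> vcarrier A \<Longrightarrow> z \<in> vcarrier A \<Longrightarrow> m (x + y) z = m x z + m y z"
    "x \<in> vcarrier A \<Longrightarrow> y \<in> vcarrier A \<Longrightarrow> z \<in> vcarrier A \<Longrightarrow> m z (x + y) = m z x + m z y"
    "x \<in> vcarrier A \<Longrightarrow> y \<in> vcarrier A \<Longrightarrow> m (vscale A c x) y = vscale A c (m x y)"
    "x \<in> vcarrier A \<Longrightarrow> y \<in> vcarrier A \<Longrightarrow> m x (vscale A c y) = vscale A c (m x y)" for x y z c
    using m by (simp_all add: bilinmap_def linmap_def)
  have left: "(\<lambda>y. if y \<in> vcarrier A then \<theta> (m x y) else 0) \<in> vcarrier (dual A)"
    and right: "(\<lambda>y. if y \<in> vcarrier A then \<theta> (m y x) else 0) \<in> vcarrier (dual A)"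
    and right': "(\<lambda>y. if y \<in> vcarrier A then - \<theta> (m y x) else 0) \<in> vcarrier (dual A)"
    if "\<theta> \<in> vcarrier (dual A)" "x \<in> vcarrier A" for \<theta> x
    by (intro mem_dual_guarded[OF vs]; use that in \<open>simp add: m' dual_add dual_scale\<close>)+
  show "prod_12_13 A m r \<phi> \<psi> \<chi> = \<phi> (m (R \<psi>) (R \<chi>))"
    using d left right by (simp add: prod_12_13_def on_dual3_def r_eval cong: if_cong)
  show "prod_12_23 A m r \<phi> \<psi> \<chi> = - \<psi> (m (R \<phi>) (R \<chi>))"
    using d left right by (simp add: prod_12_23_def on_dual3_def r_eval[of _ \<chi>] r_eval_right[of \<phi>] cong: if_cong)
  show "prod_13_23 A m r \<phi> \<psi> \<chi> = \<chi> (m (R \<phi>) (R \<psi>))"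
    using d left right' by (simp add: prod_13_23_def on_dual3_def r_eval_right[of \<psi>] r_eval_right[of \<phi>] cong: if_cong)
qed

text \<open>The trilinear identities are the quadratic parts of the equation, contracted with the three
  functionals.  The linear parts say that \<open>\<phi>(P(R\<psi>)) = \<phi>(R(\<psi> \<circ> Q))\<close> and
  \<open>\<phi>(Q(R\<psi>)) = \<phi>(R(\<psi> \<circ> P))\<close>, where \<open>\<phi>\<close> can be dropped as functionals separate points.\<close>

lemma rpybe_solution_iff_operator:
  assumes Q: "linmap A A Q"
  shows "rpybe_solution A Q r \<longleftrightarrow>
    (\<forall>\<phi>\<in>vcarrier (dual A). \<forall>\<psi>\<in>vcarrier (dual A). \<forall>\<chi>\<in>vcarrier (dual A).
      \<phi> (mul A (R \<psi>) (R \<chi>)) + \<psi> (mul A (R \<phi>) (R \<chi>)) + \<chi> (mul A (R \<phi>) (R \<psi>)) = 0) \<and>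
    (\<forall>\<phi>\<in>vcarrier (dual A). \<forall>\<psi>\<in>vcarrier (dual A). \<forall>\<chi>\<in>vcarrier (dual A).
      \<phi> (brk A (R \<psi>) (R \<chi>)) - \<psi> (brk A (R \<phi>) (R \<chi>)) + \<chi> (brk A (R \<phi>) (R \<psi>)) = 0) \<and>
    (\<forall>\<phi>\<in>vcarrier (dual A). der A (R \<phi>) = R (dual_map A Q \<phi>)) \<and>
    (\<forall>\<phi>\<in>vcarrier (dual A). Q (R \<phi>) = R (dual_map A (der A) \<phi>))"
proof -
  let ?D = "vcarrier (dual A)"
  have Qc [simp]: "x \<in> vcarrier A \<Longrightarrow> Q x \<in> vcarrier A" for x using Q by (simp add: linmap_def)
  have zero3: "F = 0 \<longleftrightarrow> (\<forall>\<phi>\<in>?D. \<forall>\<psi>\<in>?D. \<forall>\<chi>\<in>?D. F \<phi> \<psi> \<chi> = 0)"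
    if "\<And>\<phi> \<psi> \<chi>. \<not> (\<phi> \<in> ?D \<and> \<psi> \<in> ?D \<and> \<chi> \<in> ?D) \<Longrightarrow> F \<phi> \<psi> \<chi> = 0" for F :: "('k, 'a) tensor3"
    using that by (auto simp: fun_eq_iff) blast
  have off: "prod_12_13 A m r \<phi> \<psi> \<chi> = 0" "prod_12_23 A m r \<phi> \<psi> \<chi> = 0" "prod_13_23 A m r \<phi> \<psi> \<chi> = 0"
    if "\<not> (\<phi> \<in> ?D \<and> \<psi> \<in> ?D \<and> \<chi> \<in> ?D)" for m \<phi> \<psi> \<chi>
    using that unfolding prod_12_13_def prod_12_23_def prod_13_23_def on_dual3_def by auto
  have mul: "prod_12_13 A (mul A) r - prod_12_23 A (mul A) r + prod_13_23 A (mul A) r = 0 \<longleftrightarrow>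
    (\<forall>\<phi>\<in>?D. \<forall>\<psi>\<in>?D. \<forall>\<chi>\<in>?D.
      \<phi> (mul A (R \<psi>) (R \<chi>)) + \<psi> (mul A (R \<phi>) (R \<chi>)) + \<chi> (mul A (R \<phi>) (R \<psi>)) = 0)"
    by (subst zero3) (simp_all add: off prod_12_13_eval prod_12_23_eval prod_13_23_eval bilinmap_mul)
  have brk: "prod_12_13 A (brk A) r + prod_12_23 A (brk A) r + prod_13_23 A (brk A) r = 0 \<longleftrightarrow>
    (\<forall>\<phi>\<in>?D. \<forall>\<psi>\<in>?D. \<forall>\<chi>\<in>?D.
      \<phi> (brk A (R \<psi>) (R \<chi>)) - \<psi> (brk A (R \<phi>) (R \<chi>)) + \<chi> (brk A (R \<phi>) (R \<psi>)) = 0)"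
    by (subst zero3) (simp_all add: off prod_12_13_eval prod_12_23_eval prod_13_23_eval bilinmap_brk)
  have intertwine: "tensor_map A f id r - tensor_map A id g r = 0 \<longleftrightarrow> (\<forall>\<psi>\<in>?D. f (R \<psi>) = R (dual_map A g \<psi>))"
    if f: "linmap A A f" and g: "linmap A A g" for f g
  proof -
    have fc: "x \<in> vcarrier A \<Longrightarrow> f x \<in> vcarrier A" for x using f by (simp add: linmap_def)
    have "tensor_map A f id r - tensor_map A id g r = 0 \<longleftrightarrow>
        (\<forall>\<phi>\<in>?D. \<forall>\<psi>\<in>?D. \<phi> (f (R \<psi>)) = \<phi> (R (dual_map A g \<psi>)))"
      using f g by (auto simp: fun_eq_iff tensor_map_def dual_map_id r_eval dual_map_eval)
    also have "\<dots> \<longleftrightarrow> (\<forall>\<psi>\<in>?D. f (R \<psi>) = R (dual_map A g \<psi>))"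
      using dual_separates[OF vs fc R_closed] g by (metis R_closed dual_map_closed)
    finally show ?thesis .
  qed
  show ?thesis
    unfolding rpybe_solution_def mul brk intertwine[OF linmap_der Q] intertwine[OF Q linmap_der]
    using r_mem by simp
qed

end

lemma antisymmetric_operator_exists:
  assumes "relative_poisson_algebra A" and r: "r \<in> vcarrier (tensor A A)" and "antisymmetric_tensor r"
  obtains R where "antisymmetric_operator A r R"
proof -
  interpret rp_algebra A by unfold_locales fact
  obtain R where R: "linmap (dual A) A R"
    "\<And>\<phi> \<psi>. \<phi> \<in> vcarrier (dual A) \<Longrightarrow> \<psi> \<in> vcarrier (dual A) \<Longrightarrow> r \<phi> \<psi> = \<phi> (R \<psi>)"
    using tensor_operator[OF vs r] by blast
  have "r \<phi> \<psi> = - r \<psi> \<phi>" for \<phi> \<psi>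
    using assms(3) by (simp add: antisymmetric_tensor_def flip_def fun_eq_iff eq_neg_iff_add_eq_0)
  then have "antisymmetric_operator A r R"
    using R r by unfold_locales metis+
  then show ?thesis using that by blast
qed

section \<open>Coboundary bialgebras\<close>

locale coboundary = antisymmetric_operator A r R
  for A :: "('k::field, 'a::ab_group_add, 'z) rpa_scheme" and r R +
  fixes Q :: "'a \<Rightarrow> 'a"
  assumes dually: "dually_represents A Q" and solution: "rpybe_solution A Q r"
begin

lemma linmap_Q: "linmap A A Q" using dually by (simp add: dually_represents_def)

lemma Q_closed [simp]: "x \<in> vcarrier A \<Longrightarrow> Q x \<in> vcarrier A"
  using linmap_Q by (simp add: linmap_def)

lemma Q_mul: "x \<in> vcarrier A \<Longrightarrow> z \<in> vcarrier A \<Longrightarrow> Q (mul A x z) = mul A x (Q z) - mul A (der A x) z"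
  using dually dually_represents_iff[of Q] by blast

lemma Q_brk: "x \<in> vcarrier A \<Longrightarrow> z \<in> vcarrier A \<Longrightarrow> Q (brk A x z) = brk A x (Q z) - brk A (der A x) z"
  using dually dually_represents_iff[of Q] by blast

lemma Q_mul_mul: "x \<in> vcarrier A \<Longrightarrow> y \<in> vcarrier A \<Longrightarrow> z \<in> vcarrier A \<Longrightarrow>
    Q (mul A (mul A x y) z) = brk A (mul A x y) z - brk A x (mul A y z) - brk A y (mul A x z)"
  using dually dually_represents_iff[of Q] by blast

lemma R_Q [simp]: "\<phi> \<in> vcarrier (dual A) \<Longrightarrow> R (dual_map A Q \<phi>) = der A (R \<phi>)"
  and R_der [simp]: "\<phi> \<in> vcarrier (dual A) \<Longrightarrow> R (dual_map A (der A) \<phi>) = Q (R \<phi>)"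
  using solution rpybe_solution_iff_operator[OF linmap_Q] by auto

lemma yang_baxter_mul:
  "\<phi> \<in> vcarrier (dual A) \<Longrightarrow> \<psi> \<in> vcarrier (dual A) \<Longrightarrow> \<chi> \<in> vcarrier (dual A) \<Longrightarrow>
    \<phi> (mul A (R \<psi>) (R \<chi>)) + \<psi> (mul A (R \<phi>) (R \<chi>)) + \<chi> (mul A (R \<phi>) (R \<psi>)) = 0"
  and yang_baxter_brk:
  "\<phi> \<in> vcarrier (dual A) \<Longrightarrow> \<psi> \<in> vcarrier (dual A) \<Longrightarrow> \<chi> \<in> vcarrier (dual A) \<Longrightarrow>
    \<phi> (brk A (R \<psi>) (R \<chi>)) - \<psi> (brk A (R \<phi>) (R \<chi>)) + \<chi> (brk A (R \<phi>) (R \<psi>)) = 0"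
  using solution rpybe_solution_iff_operator[OF linmap_Q] by blast+

definition coprod :: "'a \<Rightarrow> ('k, 'a) tensor2" where
  "coprod u = tensor_map A id (mul A u) r - tensor_map A (mul A u) id r"

definition cobrk :: "'a \<Rightarrow> ('k, 'a) tensor2" where
  "cobrk u = tensor_map A (brk A u) id r + tensor_map A id (brk A u) r"

text \<open>Up to sign, the operations \<open>*\<close> and \<open>{ , }\<close> on the dual space.  The sign is kept
  inside, so that these are literally the functionals that occur in \<open>id_tensor\<close> and \<open>tensor_id\<close>.\<close>

definition dual_mul :: "('a \<Rightarrow> 'k) \<Rightarrow> ('a \<Rightarrow> 'k) \<Rightarrow> 'a \<Rightarrow> 'k" where
  "dual_mul \<phi> \<psi> = (\<lambda>x. if x \<in> vcarrier A then coprod x \<phi> \<psi> else 0)"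

definition dual_brk :: "('a \<Rightarrow> 'k) \<Rightarrow> ('a \<Rightarrow> 'k) \<Rightarrow> 'a \<Rightarrow> 'k" where
  "dual_brk \<phi> \<psi> = (\<lambda>x. if x \<in> vcarrier A then cobrk x \<phi> \<psi> else 0)"

lemma coprod_off: "\<not> (\<phi> \<in> vcarrier (dual A) \<and> \<psi> \<in> vcarrier (dual A)) \<Longrightarrow> coprod u \<phi> \<psi> = 0"
  and cobrk_off: "\<not> (\<phi> \<in> vcarrier (dual A) \<and> \<psi> \<in> vcarrier (dual A)) \<Longrightarrow> cobrk u \<phi> \<psi> = 0"
  by (auto simp: coprod_def cobrk_def tensor_map_def)

text \<open>Antisymmetry moves \<open>R\<close> onto the functional that is not composed with multiplication by \<open>u\<close>.
  The result is symmetric for the coproduct and skew for the cobracket.\<close>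

lemma coprod_eval:
  assumes "u \<in> vcarrier A" "\<phi> \<in> vcarrier (dual A)" "\<psi> \<in> vcarrier (dual A)"
  shows "coprod u \<phi> \<psi> = - \<phi> (mul A u (R \<psi>)) - \<psi> (mul A u (R \<phi>))"
  using assms linmap_mul[of u]
  by (simp add: coprod_def tensor_map_def dual_map_id r_eval[of "dual_map A _ _"] r_eval_right[of _ "dual_map A _ _"] dual_map_eval)

lemma cobrk_eval:
  assumes "u \<in> vcarrier A" "\<phi> \<in> vcarrier (dual A)" "\<psi> \<in> vcarrier (dual A)"
  shows "cobrk u \<phi> \<psi> = \<phi> (brk A u (R \<psi>)) - \<psi> (brk A u (R \<phi>))"
  using assms linmap_brk[of u]
  by (simp add: cobrk_def tensor_map_def dual_map_id r_eval[of "dual_map A _ _"] r_eval_right[of _ "dual_map A _ _"] dual_map_eval)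

lemma linmap_coprod: "linmap A (tensor A A) coprod"
  unfolding linmap_def
proof (intro conjI ballI allI)
  show "coprod x \<in> vcarrier (tensor A A)" if "x \<in> vcarrier A" for x
    unfolding coprod_def
    by (intro carrier_diff[OF vspace_tensor] tensor_map_mem_tensor vs linmap_id linmap_mul that r_mem)
  show "coprod (x + y) = coprod x + coprod y" if "x \<in> vcarrier A" "y \<in> vcarrier A" for x y
  proof (intro ext)
    fix \<phi> \<psi> show "coprod (x + y) \<phi> \<psi> = (coprod x + coprod y) \<phi> \<psi>"
      using that by (cases "\<phi> \<in> vcarrier (dual A) \<and> \<psi> \<in> vcarrier (dual A)")
        (auto simp: coprod_off coprod_eval mul_add dual_add)
  qed
  show "coprod (vscale A c x) = vscale (tensor A A) c (coprod x)" if "x \<in> vcarrier A" for x c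
  proof (intro ext)
    fix \<phi> \<psi> show "coprod (vscale A c x) \<phi> \<psi> = vscale (tensor A A) c (coprod x) \<phi> \<psi>"
      using that by (cases "\<phi> \<in> vcarrier (dual A) \<and> \<psi> \<in> vcarrier (dual A)")
        (auto simp: coprod_off coprod_eval mul_scale dual_scale tensor_def algebra_simps)
  qed
qed

lemma linmap_cobrk: "linmap A (tensor A A) cobrk"
  unfolding linmap_def
proof (intro conjI ballI allI)
  show "cobrk x \<in> vcarrier (tensor A A)" if "x \<in> vcarrier A" for x
    unfolding cobrk_def
    by (intro vspace_closed(2)[OF vspace_tensor] tensor_map_mem_tensor vs linmap_id linmap_brk that r_mem)
  show "cobrk (x + y) = cobrk x + cobrk y" if "x \<in> vcarrier A" "y \<in> vcarrier A" for x y
  proof (intro ext)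
    fix \<phi> \<psi> show "cobrk (x + y) \<phi> \<psi> = (cobrk x + cobrk y) \<phi> \<psi>"
      using that by (cases "\<phi> \<in> vcarrier (dual A) \<and> \<psi> \<in> vcarrier (dual A)")
        (auto simp: cobrk_off cobrk_eval brk_add dual_add)
  qed
  show "cobrk (vscale A c x) = vscale (tensor A A) c (cobrk x)" if "x \<in> vcarrier A" for x c
  proof (intro ext)
    fix \<phi> \<psi> show "cobrk (vscale A c x) \<phi> \<psi> = vscale (tensor A A) c (cobrk x) \<phi> \<psi>"
      using that by (cases "\<phi> \<in> vcarrier (dual A) \<and> \<psi> \<in> vcarrier (dual A)")
        (auto simp: cobrk_off cobrk_eval brk_scale dual_scale tensor_def algebra_simps)
  qed
qed

lemma dual_mul_closed [simp]: "dual_mul \<phi> \<psi> \<in> vcarrier (dual A)"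
  unfolding dual_mul_def using linmap_coprod
  by (intro mem_dual_guarded[OF vs]) (auto simp: linmap_def tensor_def)

lemma dual_brk_closed [simp]: "dual_brk \<phi> \<psi> \<in> vcarrier (dual A)"
  unfolding dual_brk_def using linmap_cobrk
  by (intro mem_dual_guarded[OF vs]) (auto simp: linmap_def tensor_def)

lemma dual_mul_eval:
  assumes "u \<in> vcarrier A" "\<phi> \<in> vcarrier (dual A)" "\<psi> \<in> vcarrier (dual A)"
  shows "dual_mul \<phi> \<psi> u = - \<phi> (mul A u (R \<psi>)) - \<psi> (mul A u (R \<phi>))"
  using assms by (simp add: dual_mul_def coprod_eval)

lemma dual_brk_eval:
  assumes "u \<in> vcarrier A" "\<phi> \<in> vcarrier (dual A)" "\<psi> \<in> vcarrier (dual A)"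
  shows "dual_brk \<phi> \<psi> u = \<phi> (brk A u (R \<psi>)) - \<psi> (brk A u (R \<phi>))"
  using assms by (simp add: dual_brk_def cobrk_eval)

text \<open>\<open>- R\<close> is a homomorphism from the dual space with the product dual to the coproduct: under a third
  functional, this is the Yang-Baxter identity read with one term moved to the other side.\<close>

lemma R_dual_mul [simp]:
  assumes d: "\<phi> \<in> vcarrier (dual A)" "\<psi> \<in> vcarrier (dual A)"
  shows "R (dual_mul \<phi> \<psi>) = - mul A (R \<phi>) (R \<psi>)"
proof (rule dual_separates[OF vs])
  fix \<chi> assume \<chi>: "\<chi> \<in> vcarrier (dual A)"
  have "\<chi> (R (dual_mul \<phi> \<psi>)) = \<phi> (mul A (R \<chi>) (R \<psi>)) + \<psi> (mul A (R \<chi>) (R \<phi>))"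
    using d \<chi> by (subst skew) (simp_all add: dual_mul_eval)
  then show "\<chi> (R (dual_mul \<phi> \<psi>)) = \<chi> (- mul A (R \<phi>) (R \<psi>))"
    using yang_baxter_mul[OF d \<chi>] d \<chi> by (simp add: dual_uminus[OF vs] mul_comm eq_neg_iff_add_eq_0)
qed (use d in simp_all)

lemma R_dual_brk [simp]:
  assumes d: "\<phi> \<in> vcarrier (dual A)" "\<psi> \<in> vcarrier (dual A)"
  shows "R (dual_brk \<phi> \<psi>) = - brk A (R \<phi>) (R \<psi>)"
proof (rule dual_separates[OF vs])
  fix \<chi> assume \<chi>: "\<chi> \<in> vcarrier (dual A)"
  have "\<chi> (R (dual_brk \<phi> \<psi>)) = - \<phi> (brk A (R \<chi>) (R \<psi>)) + \<psi> (brk A (R \<chi>) (R \<phi>))"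
    using d \<chi> by (subst skew) (simp_all add: dual_brk_eval)
  also have "\<dots> = \<phi> (brk A (R \<psi>) (R \<chi>)) - \<psi> (brk A (R \<phi>) (R \<chi>))"
    using d \<chi> by (simp add: brk_anti[of "R \<chi>"] dual_uminus[OF vs])
  finally show "\<chi> (R (dual_brk \<phi> \<psi>)) = \<chi> (- brk A (R \<phi>) (R \<psi>))"
    using yang_baxter_brk[OF d \<chi>] d \<chi> by (simp add: dual_uminus[OF vs] eq_neg_iff_add_eq_0)
qed (use d in simp_all)

text \<open>Antisymmetry for composed functionals.  In the cocycle conditions, the terms where \<open>R\<close>
  meets such a composition cancel in pairs by this rule.\<close>

lemma skew_maps:
  assumes "linmap A A f" "linmap A A g" "\<phi> \<in> vcarrier (dual A)" "\<psi> \<in> vcarrier (dual A)"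
  shows "\<psi> (f (R (dual_map A g \<phi>))) = - \<phi> (g (R (dual_map A f \<psi>)))"
  using skew[of "dual_map A f \<psi>" "dual_map A g \<phi>"] assms by (simp add: dual_map_eval)

text \<open>Contracting one tensor factor of a twofold coproduct or cobracket means inserting a product or
  bracket of functionals; so coalgebra axioms become algebra axioms on the dual space.\<close>

lemma id_tensor_eval:
  assumes "\<phi> \<in> vcarrier (dual A)" "\<psi> \<in> vcarrier (dual A)" "\<chi> \<in> vcarrier (dual A)"
  shows "id_tensor A coprod t \<phi> \<psi> \<chi> = t \<phi> (dual_mul \<psi> \<chi>)"
    and "id_tensor A cobrk t \<phi> \<psi> \<chi> = t \<phi> (dual_brk \<psi> \<chi>)"
    and "tensor_id A coprod t \<phi> \<psi> \<chi> = t (dual_mul \<phi> \<psi>) \<chi>"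
    and "tensor_id A cobrk t \<phi> \<psi> \<chi> = t (dual_brk \<phi> \<psi>) \<chi>"
  using assms by (simp_all add: id_tensor_def tensor_id_def on_dual3_def dual_mul_def dual_brk_def)

lemma tensor2_ext:
  assumes "\<And>\<phi> \<psi>. \<phi> \<in> vcarrier (dual A) \<Longrightarrow> \<psi> \<in> vcarrier (dual A) \<Longrightarrow> s \<phi> \<psi> = t \<phi> \<psi>"
    and "\<And>\<phi> \<psi>. \<not> (\<phi> \<in> vcarrier (dual A) \<and> \<psi> \<in> vcarrier (dual A)) \<Longrightarrow> s \<phi> \<psi> = t \<phi> \<psi>"
  shows "s = t"
  using assms by (intro ext) blast

lemma tensor3_ext:
  assumes "\<And>\<phi> \<psi> \<chi>. \<phi> \<in> vcarrier (dual A) \<Longrightarrow> \<psi> \<in> vcarrier (dual A) \<Longrightarrow> \<chi> \<in> vcarrier (dual A) \<Longrightarrow>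
      s \<phi> \<psi> \<chi> = t \<phi> \<psi> \<chi>"
    and "\<And>\<phi> \<psi> \<chi>. \<not> (\<phi> \<in> vcarrier (dual A) \<and> \<psi> \<in> vcarrier (dual A) \<and> \<chi> \<in> vcarrier (dual A)) \<Longrightarrow>
      s \<phi> \<psi> \<chi> = t \<phi> \<psi> \<chi>"
  shows "s = t"
  using assms by (intro ext) blast

lemmas linmaps [simp] = linmap_Q linmap_der linmap_mul linmap_brk linmap_id
lemmas evals = coprod_eval cobrk_eval dual_mul_eval dual_brk_eval id_tensor_eval dual_map_eval
  dual_map_id mul_uminus brk_uminus dual_uminus[OF vs]
lemmas offs = coprod_off cobrk_off id_tensor_def tensor_id_def on_dual3_def tensor_map_def
  flip_def flip12_def cyc_def map_first_def

lemma flip_coprod: "u \<in> vcarrier A \<Longrightarrow> flip (coprod u) = coprod u"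
  by (rule tensor2_ext) (auto simp: flip_def coprod_off coprod_eval)

lemma flip_cobrk: "u \<in> vcarrier A \<Longrightarrow> flip (cobrk u) = - cobrk u"
  by (rule tensor2_ext) (auto simp: flip_def cobrk_off cobrk_eval)

text \<open>Both sides evaluate to \<open>\<phi>(u \<cdot> R\<psi> \<cdot> R\<chi>) + \<psi>(u \<cdot> R\<phi> \<cdot> R\<chi>) + \<chi>(u \<cdot> R\<phi> \<cdot> R\<psi>)\<close>.\<close>

lemma coassociative: "u \<in> vcarrier A \<Longrightarrow> id_tensor A coprod (coprod u) = tensor_id A coprod (coprod u)"
  by (rule tensor3_ext) (auto simp: evals mul_ac, auto simp: offs)

text \<open>Under each functional, the three terms contributed by the cyclic sum form a Jacobi identity for
  \<open>u\<close> and the images under \<open>R\<close> of the other two functionals.\<close>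

lemma co_jacobi:
  assumes u: "u \<in> vcarrier A"
  shows "id_tensor A cobrk (cobrk u) + cyc (id_tensor A cobrk (cobrk u))
    + cyc (cyc (id_tensor A cobrk (cobrk u))) = 0"
proof (rule tensor3_ext)
  fix \<phi> \<psi> \<chi> assume d: "\<phi> \<in> vcarrier (dual A)" "\<psi> \<in> vcarrier (dual A)" "\<chi> \<in> vcarrier (dual A)"
  show "(id_tensor A cobrk (cobrk u) + cyc (id_tensor A cobrk (cobrk u))
    + cyc (cyc (id_tensor A cobrk (cobrk u)))) \<phi> \<psi> \<chi> = 0 \<phi> \<psi> \<chi>"
    using u d by (simp add: cyc_def evals functional_jacobi[symmetric])
qed (auto simp: offs)

text \<open>The composition with \<open>Q\<close> inside \<open>R\<close> comes out as \<open>P\<close>, by the linear part of the Yang-Baxter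
  equation; the rest is the rule for \<open>Q\<close> of a product.\<close>

lemma coprod_Q:
  assumes u: "u \<in> vcarrier A"
  shows "coprod (Q u) = tensor_map A Q id (coprod u) + tensor_map A id Q (coprod u)"
proof (rule tensor2_ext)
  fix \<phi> \<psi> assume d: "\<phi> \<in> vcarrier (dual A)" "\<psi> \<in> vcarrier (dual A)"
  have Q: "\<theta> (Q (mul A u (R \<eta>))) = \<theta> (mul A (Q u) (R \<eta>)) - \<theta> (mul A u (der A (R \<eta>)))"
    if "\<theta> \<in> vcarrier (dual A)" "\<eta> \<in> vcarrier (dual A)" for \<theta> \<eta>
    using Q_mul[of "R \<eta>" u] that u by (simp add: mul_comm[of _ "R \<eta>"] mul_comm[of u] dual_diff[OF vs])
  show "coprod (Q u) \<phi> \<psi> = (tensor_map A Q id (coprod u) + tensor_map A id Q (coprod u)) \<phi> \<psi>"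
    using u d by (simp add: tensor_map_def evals Q)
qed (auto simp: offs)

lemma cobrk_Q:
  assumes u: "u \<in> vcarrier A"
  shows "cobrk (Q u) = tensor_map A Q id (cobrk u) + tensor_map A id Q (cobrk u)"
proof (rule tensor2_ext)
  fix \<phi> \<psi> assume d: "\<phi> \<in> vcarrier (dual A)" "\<psi> \<in> vcarrier (dual A)"
  have Q: "\<theta> (Q (brk A u (R \<eta>))) = \<theta> (brk A (Q u) (R \<eta>)) - \<theta> (brk A u (der A (R \<eta>)))"
    if "\<theta> \<in> vcarrier (dual A)" "\<eta> \<in> vcarrier (dual A)" for \<theta> \<eta>
  proof -
    have "Q (brk A u (R \<eta>)) = Q (- brk A (R \<eta>) u)" using that u by (simp add: brk_anti[of u])
    also have "\<dots> = - (brk A (R \<eta>) (Q u) - brk A (der A (R \<eta>)) u)"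
      using that u by (simp only: linmap_uminus[OF vs linmap_Q] Q_brk closed R_closed)
    also have "\<dots> = brk A (Q u) (R \<eta>) - brk A u (der A (R \<eta>))"
      using that u by (simp add: brk_anti[of "Q u"] brk_anti[of u])
    finally show ?thesis using that u by (simp add: dual_diff[OF vs])
  qed
  show "cobrk (Q u) \<phi> \<psi> = (tensor_map A Q id (cobrk u) + tensor_map A id Q (cobrk u)) \<phi> \<psi>"
    using u d by (simp add: tensor_map_def evals Q)
qed (auto simp: offs)

lemma functional_Q_mul_mul:
  assumes "\<phi> \<in> vcarrier (dual A)" "x \<in> vcarrier A" "y \<in> vcarrier A" "z \<in> vcarrier A"
  shows "\<phi> (Q (mul A (mul A x y) z)) = \<phi> (brk A (mul A x y) z) - \<phi> (brk A x (mul A y z)) - \<phi> (brk A y (mul A x z))"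
  using assms by (simp only: Q_mul_mul dual_diff[OF vs] closed)

lemma functional_Q_mul_mul_swapped:
  assumes "\<phi> \<in> vcarrier (dual A)" "x \<in> vcarrier A" "y \<in> vcarrier A" "z \<in> vcarrier A"
  shows "\<phi> (Q (mul A (mul A x y) z)) = \<phi> (brk A (mul A y z) x) + \<phi> (brk A (mul A x z) y) - \<phi> (brk A z (mul A x y))"
  using assms functional_Q_mul_mul[OF assms] functional_brk_anti[of \<phi> x "mul A y z"] functional_brk_anti[of \<phi> y "mul A x z"]
    functional_brk_anti[of \<phi> z "mul A x y"]
  by simp

text \<open>The terms under \<open>\<phi>\<close> form the third condition on \<open>Q\<close> for the dual representation; those under
  \<open>\<psi>\<close> and under \<open>\<chi>\<close> are instances of the relative Leibniz rule.\<close>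

lemma co_leibniz:
  assumes u: "u \<in> vcarrier A"
  shows "id_tensor A coprod (cobrk u) - tensor_id A cobrk (coprod u) - flip12 (id_tensor A cobrk (coprod u))
    - map_first A Q (tensor_id A coprod (coprod u)) = 0"
proof (rule tensor3_ext)
  fix \<phi> \<psi> \<chi> assume d: "\<phi> \<in> vcarrier (dual A)" "\<psi> \<in> vcarrier (dual A)" "\<chi> \<in> vcarrier (dual A)"
  let ?a = "R \<phi>" and ?b = "R \<psi>" and ?c = "R \<chi>"
  have 1: "\<phi> (Q (mul A (mul A ?b ?c) u)) = \<phi> (brk A (mul A ?c u) ?b) + \<phi> (brk A (mul A ?b u) ?c) - \<phi> (brk A u (mul A ?b ?c))"
    using u d by (intro functional_Q_mul_mul_swapped) simp_all
  have 2: "\<theta> (brk A (mul A u x) ?a) = \<theta> (mul A x (brk A u ?a)) - \<theta> (mul A u (brk A ?a x)) - \<theta> (mul A (mul A u x) (der A ?a))"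
    if "\<theta> \<in> vcarrier (dual A)" "x \<in> vcarrier A" for \<theta> x
    using u d that functional_leibniz_right[of \<theta> u x ?a] functional_mul_brk_anti[of \<theta> x ?a u] by simp
  show "(id_tensor A coprod (cobrk u) - tensor_id A cobrk (coprod u) - flip12 (id_tensor A cobrk (coprod u))
      - map_first A Q (tensor_id A coprod (coprod u))) \<phi> \<psi> \<chi> = 0 \<phi> \<psi> \<chi>"
    using u d 1 2[of \<psi> ?c] 2[of \<chi> ?b]
    by (simp add: map_first_def on_dual3_def flip12_def evals mul_ac)
qed (auto simp: offs)

text \<open>Under \<open>\<phi>\<close> this is the derivation rule for \<open>P\<close>, under \<open>\<psi>\<close> the rule for \<open>Q\<close> of a product.\<close>

lemma coprod_der:
  assumes u: "u \<in> vcarrier A"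
  shows "coprod (der A u) = tensor_map A (der A) id (coprod u) - tensor_map A id Q (coprod u)"
proof (rule tensor2_ext)
  fix \<phi> \<psi> assume d: "\<phi> \<in> vcarrier (dual A)" "\<psi> \<in> vcarrier (dual A)"
  show "coprod (der A u) \<phi> \<psi> = (tensor_map A (der A) id (coprod u) - tensor_map A id Q (coprod u)) \<phi> \<psi>"
    using u d by (simp add: tensor_map_def evals Q_mul der_mul dual_add dual_diff[OF vs])
qed (auto simp: offs)

lemma cobrk_der:
  assumes u: "u \<in> vcarrier A"
  shows "cobrk (der A u) = tensor_map A (der A) id (cobrk u) - tensor_map A id Q (cobrk u)"
proof (rule tensor2_ext)
  fix \<phi> \<psi> assume d: "\<phi> \<in> vcarrier (dual A)" "\<psi> \<in> vcarrier (dual A)"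
  show "cobrk (der A u) \<phi> \<psi> = (tensor_map A (der A) id (cobrk u) - tensor_map A id Q (cobrk u)) \<phi> \<psi>"
    using u d by (simp add: tensor_map_def evals Q_brk der_brk dual_add dual_diff[OF vs])
qed (auto simp: offs)

text \<open>Although \<open>Q\<close> need not equal \<open>- P\<close>, it does so on triple products: expanding the three
  brackets in the third condition on \<open>Q\<close> by the relative Leibniz rule, everything but \<open>- P(x y z)\<close>
  cancels.  Comparing this with the rule for \<open>Q\<close> of a product gives the identity.\<close>

lemma triple_mul_der_plus_Q:
  assumes d: "\<phi> \<in> vcarrier (dual A)" and c: "x \<in> vcarrier A" "y \<in> vcarrier A" "z \<in> vcarrier A"
  shows "\<phi> (mul A (mul A x y) (der A z)) + \<phi> (mul A (mul A x y) (Q z)) = 0"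
proof -
  have "\<phi> (brk A (mul A x y) z) = \<phi> (mul A y (brk A x z)) + \<phi> (mul A x (brk A y z)) - \<phi> (mul A (mul A x y) (der A z))"
    using d c by (rule functional_leibniz_right)
  moreover have "\<phi> (brk A x (mul A y z)) = \<phi> (mul A z (brk A x y)) + \<phi> (mul A y (brk A x z)) + \<phi> (mul A (mul A y z) (der A x))"
    using functional_leibniz[OF d c(2,3,1)] c by (simp add: mul_comm[of "brk A x y"])
  moreover have "\<phi> (brk A y (mul A x z)) = - \<phi> (mul A z (brk A x y)) + \<phi> (mul A x (brk A y z)) + \<phi> (mul A (mul A x z) (der A y))"
    using functional_leibniz[OF d c(1,3,2)] c d functional_mul_brk_anti[of \<phi> y x z] by (simp add: mul_comm[of "brk A y x"])
  ultimately have "\<phi> (Q (mul A (mul A x y) z)) =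
      - \<phi> (mul A (mul A x y) (der A z)) - \<phi> (mul A (mul A y z) (der A x)) - \<phi> (mul A (mul A x z) (der A y))"
    using functional_Q_mul_mul[OF d c] by simp
  moreover have "\<phi> (Q (mul A (mul A x y) z)) = \<phi> (mul A (mul A x y) (Q z)) - \<phi> (mul A (mul A (der A x) y) z) - \<phi> (mul A (mul A x (der A y)) z)"
    using d c by (simp only: Q_mul der_mul mul_add closed Q_closed dual_diff[OF vs] dual_add diff_diff_eq)
  ultimately show ?thesis using c by (simp add: mul_ac) algebra
qed

text \<open>The iterated coproduct at \<open>w\<close> only involves \<open>w\<close> multiplied by two elements.\<close>

lemma coprod_coprod_der_plus_Q:
  assumes u: "u \<in> vcarrier A"
  shows "tensor_id A coprod (coprod (der A u + Q u)) = 0"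
proof (rule tensor3_ext)
  fix \<phi> \<psi> \<chi> assume d: "\<phi> \<in> vcarrier (dual A)" "\<psi> \<in> vcarrier (dual A)" "\<chi> \<in> vcarrier (dual A)"
  have "\<theta> (mul A x (mul A y (der A u))) + \<theta> (mul A x (mul A y (Q u))) = 0"
    if "\<theta> \<in> vcarrier (dual A)" "x \<in> vcarrier A" "y \<in> vcarrier A" for \<theta> x y
    using triple_mul_der_plus_Q[OF that u] that u by (simp add: mul_assoc)
  from this[OF d(1), of "R \<psi>" "R \<chi>"] this[OF d(2), of "R \<phi>" "R \<chi>"] this[OF d(3), of "R \<phi>" "R \<psi>"]
  show "tensor_id A coprod (coprod (der A u + Q u)) \<phi> \<psi> \<chi> = 0 \<phi> \<psi> \<chi>"
    using u d by (simp add: evals mul_add dual_add dual_diff[OF vs] mul_ac) algebra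
qed (auto simp: offs)

lemma coprod_mul:
  assumes x: "x \<in> vcarrier A" and y: "y \<in> vcarrier A"
  shows "coprod (mul A x y) = tensor_map A (mul A x) id (coprod y) + tensor_map A id (mul A y) (coprod x)"
proof (rule tensor2_ext)
  fix \<phi> \<psi> assume d: "\<phi> \<in> vcarrier (dual A)" "\<psi> \<in> vcarrier (dual A)"
  have "\<psi> (mul A y (R (dual_map A (mul A x) \<phi>))) = - \<phi> (mul A x (R (dual_map A (mul A y) \<psi>)))"
    using x y d by (intro skew_maps) simp_all
  then show "coprod (mul A x y) \<phi> \<psi>
      = (tensor_map A (mul A x) id (coprod y) + tensor_map A id (mul A y) (coprod x)) \<phi> \<psi>"
    using x y d by (simp add: tensor_map_def evals mul_ac)
qed (auto simp: offs)

lemma cobrk_brk: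
  assumes x: "x \<in> vcarrier A" and y: "y \<in> vcarrier A"
  shows "cobrk (brk A x y) =
    (tensor_map A (brk A x) id (cobrk y) + tensor_map A id (brk A x) (cobrk y))
    - (tensor_map A (brk A y) id (cobrk x) + tensor_map A id (brk A y) (cobrk x))"
proof (rule tensor2_ext)
  fix \<phi> \<psi> assume d: "\<phi> \<in> vcarrier (dual A)" "\<psi> \<in> vcarrier (dual A)"
  have "\<psi> (brk A y (R (dual_map A (brk A x) \<phi>))) = - \<phi> (brk A x (R (dual_map A (brk A y) \<psi>)))"
    "\<psi> (brk A x (R (dual_map A (brk A y) \<phi>))) = - \<phi> (brk A y (R (dual_map A (brk A x) \<psi>)))"
    using x y d by (auto intro!: skew_maps)
  then show "cobrk (brk A x y) \<phi> \<psi> =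
      ((tensor_map A (brk A x) id (cobrk y) + tensor_map A id (brk A x) (cobrk y))
        - (tensor_map A (brk A y) id (cobrk x) + tensor_map A id (brk A y) (cobrk x))) \<phi> \<psi>"
    using x y d by (simp add: tensor_map_def evals jacobi_derivation dual_diff[OF vs])
qed (auto simp: offs)

text \<open>Under \<open>\<phi>\<close> this is the relative Leibniz rule and under \<open>\<psi>\<close> the third condition on \<open>Q\<close>, after
  the terms with composed functionals have cancelled.\<close>

lemma cobrk_mul:
  assumes x: "x \<in> vcarrier A" and y: "y \<in> vcarrier A"
  shows "cobrk (mul A x y) - tensor_map A id (brk A y) (coprod x) - tensor_map A (mul A x) id (cobrk y)
    - tensor_map A id (brk A x) (coprod y) - tensor_map A (mul A y) id (cobrk x)
    - tensor_map A id Q (coprod (mul A x y)) = 0"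
proof (rule tensor2_ext)
  fix \<phi> \<psi> assume d: "\<phi> \<in> vcarrier (dual A)" "\<psi> \<in> vcarrier (dual A)"
  have skews: "\<psi> (brk A y (R (dual_map A (mul A x) \<phi>))) = - \<phi> (mul A x (R (dual_map A (brk A y) \<psi>)))"
    "\<psi> (brk A x (R (dual_map A (mul A y) \<phi>))) = - \<phi> (mul A y (R (dual_map A (brk A x) \<psi>)))"
    using x y d by (auto intro!: skew_maps)
  have 1: "\<phi> (brk A (mul A x y) (R \<psi>)) = \<phi> (mul A y (brk A x (R \<psi>))) + \<phi> (mul A x (brk A y (R \<psi>)))
      - \<phi> (mul A (mul A x y) (der A (R \<psi>)))"
    using x y d by (intro functional_leibniz_right) simp_all
  have 2: "\<psi> (Q (mul A (mul A x y) (R \<phi>))) = \<psi> (brk A (mul A x y) (R \<phi>)) - \<psi> (brk A x (mul A y (R \<phi>)))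
      - \<psi> (brk A y (mul A x (R \<phi>)))"
    using x y d by (intro functional_Q_mul_mul) simp_all
  show "(cobrk (mul A x y) - tensor_map A id (brk A y) (coprod x) - tensor_map A (mul A x) id (cobrk y)
      - tensor_map A id (brk A x) (coprod y) - tensor_map A (mul A y) id (cobrk x)
      - tensor_map A id Q (coprod (mul A x y))) \<phi> \<psi> = 0 \<phi> \<psi>"
    using x y d by (simp add: tensor_map_def evals skews 1 2)
qed (auto simp: offs)

text \<open>This is the relative Leibniz rule for \<open>[x, y z]\<close>, with \<open>z\<close> the image under \<open>R\<close> of the other
  functional, after the terms with composed functionals have cancelled.\<close>

lemma coprod_brk:
  assumes x: "x \<in> vcarrier A" and y: "y \<in> vcarrier A"
  shows "coprod (brk A x y) - tensor_map A (mul A y) id (cobrk x) - tensor_map A id (brk A x) (coprod y)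
    + tensor_map A id (mul A y) (cobrk x) - tensor_map A (brk A x) id (coprod y)
    + coprod (mul A (der A x) y) = 0"
proof (rule tensor2_ext)
  fix \<phi> \<psi> assume d: "\<phi> \<in> vcarrier (dual A)" "\<psi> \<in> vcarrier (dual A)"
  have skews: "\<psi> (brk A x (R (dual_map A (mul A y) \<phi>))) = - \<phi> (mul A y (R (dual_map A (brk A x) \<psi>)))"
    "\<psi> (mul A y (R (dual_map A (brk A x) \<phi>))) = - \<phi> (brk A x (R (dual_map A (mul A y) \<psi>)))"
    using x y d by (auto intro!: skew_maps)
  have 1: "\<theta> (brk A x (mul A y z)) = \<theta> (mul A (brk A x y) z) + \<theta> (mul A y (brk A x z)) + \<theta> (mul A (mul A (der A x) y) z)"
    if "\<theta> \<in> vcarrier (dual A)" "z \<in> vcarrier A" for \<theta> z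
    using that x y by (simp add: functional_leibniz mul_ac)
  show "(coprod (brk A x y) - tensor_map A (mul A y) id (cobrk x) - tensor_map A id (brk A x) (coprod y)
      + tensor_map A id (mul A y) (cobrk x) - tensor_map A (brk A x) id (coprod y)
      + coprod (mul A (der A x) y)) \<phi> \<psi> = 0 \<phi> \<psi>"
    using x y d by (simp add: tensor_map_def evals skews 1)
qed (auto simp: offs)

lemma bialgebra: "relative_poisson_bialgebra A coprod cobrk Q"
  unfolding relative_poisson_bialgebra_def relative_poisson_coalgebra_def
  by (intro conjI ballI rpa fd linmap_coprod linmap_cobrk linmap_Q flip_coprod coassociative flip_cobrk
      co_jacobi coprod_Q cobrk_Q co_leibniz dually coprod_der cobrk_der coprod_coprod_der_plus_Q
      coprod_mul cobrk_brk cobrk_mul coprod_brk)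

end

theorem coboundary_bialgebra:
  assumes "relative_poisson_algebra A" "dually_represents A Q"
    and "antisymmetric_tensor r" "rpybe_solution A Q r"
  shows "relative_poisson_bialgebra A
    (\<lambda>u. tensor_map A id (mul A u) r - tensor_map A (mul A u) id r)
    (\<lambda>u. tensor_map A (brk A u) id r + tensor_map A id (brk A u) r) Q"
proof -
  have "r \<in> vcarrier (tensor A A)" using assms(4) by (simp add: rpybe_solution_def)
  then obtain R where "antisymmetric_operator A r R"
    using antisymmetric_operator_exists assms(1,3) by blast
  then interpret antisymmetric_operator A r R .
  interpret coboundary A r R Q by unfold_locales fact+
  show ?thesis using bialgebra unfolding coprod_def[abs_def] cobrk_def[abs_def] .
qed

section \<open>Semi-direct products with dual representations\<close>

locale dual_semidirect = rp_compatible A V \<mu> \<rho>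
  for A :: "('k::field, 'a::ab_group_add) rpa"
    and V :: "('k, 'v::ab_group_add) vsp" and \<mu> \<rho> +
  fixes \<beta> :: "'v \<Rightarrow> 'v"
  assumes beta: "dually_represents_on A V \<mu> \<rho> \<beta>"
begin

definition W :: "('k, 'a \<times> ('v \<Rightarrow> 'k)) rpa" where
  "W = semidirect A (dual V) (- dual_action V \<mu>) (dual_action V \<rho>) (dual_map V \<beta>)"

lemma linmap_beta: "linmap V V \<beta>" using beta by (simp add: dually_represents_on_def)

lemma beta_closed [simp]: "v \<in> vcarrier V \<Longrightarrow> \<beta> v \<in> vcarrier V"
  using linmap_beta by (simp add: linmap_def)

lemma vsD: "vspace (dual V)" by (rule vspace_dual[OF vsV])

lemma W_simps [simp]:
  "vcarrier W = vcarrier A \<times> vcarrier (dual V)"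
  "mul W (x, w) (y, z) = (mul A x y, - dual_action V \<mu> x z - dual_action V \<mu> y w)"
  "brk W (x, w) (y, z) = (brk A x y, dual_action V \<rho> x z - dual_action V \<rho> y w)"
  "der W (x, w) = (der A x, dual_map V \<beta> w)"
  by (simp_all add: W_def semidirect_def)

lemma W_scale: "vscale W c (x, w) = (vscale A c x, vscale (dual V) c w)"
  by (simp add: W_def semidirect_def)

lemma rpaW: "relative_poisson_algebra W"
proof -
  interpret D: rp_representation A "dual V" "- dual_action V \<mu>" "dual_action V \<rho>" "dual_map V \<beta>"
    using beta by unfold_locales (simp_all add: dually_represents_on_def rpa_rep_def)
  show ?thesis unfolding W_def by (rule D.relative_poisson_algebra_semidirect)
qed

sublocale W: rp_algebra W by unfold_locales (rule rpaW)

definition pairing :: "('a \<Rightarrow> 'k) \<Rightarrow> 'v \<Rightarrow> 'a \<times> ('v \<Rightarrow> 'k) \<Rightarrow> 'k" where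
  "pairing f u = (\<lambda>p. if p \<in> vcarrier W then f (fst p) + snd p u else 0)"

lemma pairing_apply [simp]:
  "x \<in> vcarrier A \<Longrightarrow> w \<in> vcarrier (dual V) \<Longrightarrow> pairing f u (x, w) = f x + w u"
  by (simp add: pairing_def)

lemma vscale_dual_apply: "vscale (dual V) c w u = c * w u"
  by (simp add: dual_def)

lemma pairing_mem_dual:
  assumes "f \<in> vcarrier (dual A)" shows "pairing f u \<in> vcarrier (dual W)"
  unfolding pairing_def
proof (rule mem_dual_guarded[OF W.vs])
  show "f (fst (p + q)) + snd (p + q) u = f (fst p) + snd p u + (f (fst q) + snd q u)"
    if "p \<in> vcarrier W" "q \<in> vcarrier W" for p q
    using that assms by (auto simp: dual_add)
  show "f (fst (vscale W c p)) + snd (vscale W c p) u = c * (f (fst p) + snd p u)"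
    if "p \<in> vcarrier W" for c p
    using that assms by (auto simp: W_scale dual_scale vscale_dual_apply algebra_simps)
qed

text \<open>Restrict the functional to the two summands and use reflexivity of \<open>V\<close> on the second.\<close>

lemma dual_W_cases:
  assumes \<phi>: "\<phi> \<in> vcarrier (dual W)"
  obtains f u where "f \<in> vcarrier (dual A)" "u \<in> vcarrier V" "\<phi> = pairing f u"
proof -
  note 0 = vspace_closed(1)[OF vs] vspace_closed(1)[OF vsD]
  let ?f = "\<lambda>x. if x \<in> vcarrier A then \<phi> (x, 0) else 0"
  let ?F = "\<lambda>w. if w \<in> vcarrier (dual V) then \<phi> (0, w) else 0"
  have z: "vscale (dual V) c 0 = 0" "vscale A c 0 = 0" for c
  proof -
    interpret a: vector_space "vscale A" using vs by (simp add: vspace_def)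
    interpret d: vector_space "vscale (dual V)" using vsD by (simp add: vspace_def)
    show "vscale (dual V) c 0 = 0" "vscale A c 0 = 0" by simp_all
  qed
  have f: "?f \<in> vcarrier (dual A)"
  proof (rule mem_dual_guarded[OF vs])
    show "\<phi> (x + y, 0) = \<phi> (x, 0) + \<phi> (y, 0)" if "x \<in> vcarrier A" "y \<in> vcarrier A" for x y
      using dual_add[OF \<phi>, of "(x, 0)" "(y, 0)"] that 0 by simp
    show "\<phi> (vscale A c x, 0) = c * \<phi> (x, 0)" if "x \<in> vcarrier A" for c x
      using dual_scale[OF \<phi>, of "(x, 0)" c] that 0 by (simp add: W_scale z)
  qed
  have "?F \<in> vcarrier (dual (dual V))"
  proof (rule mem_dual_guarded[OF vsD])
    show "\<phi> (0, x + y) = \<phi> (0, x) + \<phi> (0, y)" if "x \<in> vcarrier (dual V)" "y \<in> vcarrier (dual V)" for x y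
      using dual_add[OF \<phi>, of "(0, x)" "(0, y)"] that 0 by simp
    show "\<phi> (0, vscale (dual V) c x) = c * \<phi> (0, x)" if "x \<in> vcarrier (dual V)" for c x
      using dual_scale[OF \<phi>, of "(0, x)" c] that 0 by (simp add: W_scale z)
  qed
  from bidual_reflexive[OF fdV this]
  obtain u where u: "u \<in> vcarrier V" "\<And>w. w \<in> vcarrier (dual V) \<Longrightarrow> ?F w = w u" by blast
  have "\<phi> = pairing ?f u"
  proof (rule dual_eqI[OF \<phi> pairing_mem_dual[OF f]])
    fix p assume "p \<in> vcarrier W"
    then obtain x w where p: "p = (x, w)" "x \<in> vcarrier A" "w \<in> vcarrier (dual V)" by auto
    have "\<phi> (x, w) = \<phi> (x, 0) + \<phi> (0, w)" using dual_add[OF \<phi>, of "(x, 0)" "(0, w)"] p 0 by simp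
    then show "\<phi> p = pairing ?f u p" using u(2)[OF p(3)] p by simp
  qed
  then show ?thesis using that f u(1) by blast
qed

lemma dual_map_V_closed [simp]:
  "linmap V V f \<Longrightarrow> w \<in> vcarrier (dual V) \<Longrightarrow> dual_map V f w \<in> vcarrier (dual V)"
  by (rule dual_map_mem[OF vsV])

lemma dual_V_closed [simp]:
  "0 \<in> vcarrier (dual V)"
  "w \<in> vcarrier (dual V) \<Longrightarrow> z \<in> vcarrier (dual V) \<Longrightarrow> w + z \<in> vcarrier (dual V)"
  "w \<in> vcarrier (dual V) \<Longrightarrow> z \<in> vcarrier (dual V) \<Longrightarrow> w - z \<in> vcarrier (dual V)"
  "w \<in> vcarrier (dual V) \<Longrightarrow> - w \<in> vcarrier (dual V)"
  "x \<in> vcarrier A \<Longrightarrow> w \<in> vcarrier (dual V) \<Longrightarrow> dual_action V \<rho> x w \<in> vcarrier (dual V)"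
  "x \<in> vcarrier A \<Longrightarrow> w \<in> vcarrier (dual V) \<Longrightarrow> dual_action V \<mu> x w \<in> vcarrier (dual V)"
  using vspace_closed[OF vsD] carrier_diff[OF vsD] carrier_uminus[OF vsD]
    bilinmap_dual_action(1)[OF vsV bilinmap_actions(1)] bilinmap_dual_action(1)[OF vsV bilinmap_actions(2)]
  by (simp_all add: bilinmap_def linmap_def)

text \<open>In the component \<open>V\<^sup>*\<close>, every term contains exactly one functional of the factors.  If that
  functional belongs to the factor acted on by \<open>Q + \<alpha>\<^sup>*\<close>, or if the condition is the one on triple
  products, its coefficient vanishes by the conditions on \<open>\<alpha>\<close>; otherwise, by the additional equations.\<close>

lemma dually_represents_semidirect:
  assumes Q: "dually_represents A Q" and rep: "rpa_rep A V \<mu> \<rho> \<alpha>"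
    and \<mu>Q: "\<And>x v. x \<in> vcarrier A \<Longrightarrow> v \<in> vcarrier V \<Longrightarrow> \<mu> (Q x) v = \<mu> x (\<alpha> v) + \<beta> (\<mu> x v)"
    and \<rho>Q: "\<And>x v. x \<in> vcarrier A \<Longrightarrow> v \<in> vcarrier V \<Longrightarrow> \<rho> (Q x) v = \<rho> x (\<alpha> v) + \<beta> (\<rho> x v)"
  shows "dually_represents W (map_prod Q (dual_map V \<alpha>))" (is "dually_represents W ?Q")
proof -
  interpret rp_representation A V \<mu> \<rho> \<alpha> by unfold_locales fact
  have linQ: "linmap A A Q" using Q by (simp add: dually_represents_def)
  have Qc [simp]: "x \<in> vcarrier A \<Longrightarrow> Q x \<in> vcarrier A" for x using linQ by (simp add: linmap_def)
  note Q' = Q[unfolded dually_represents_iff]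
  note lin = linmap_dual_map[OF vsV linmap_alpha]
  note ev = dual_map_def dual_action_def fun_eq_iff
  show ?thesis unfolding W.dually_represents_iff
  proof (intro conjI ballI)
    show "linmap W W ?Q"
      using linQ lin by (auto simp: linmap_def W_scale)
  next
    fix p q assume "p \<in> vcarrier W" "q \<in> vcarrier W"
    then obtain x w y z where p: "p = (x, w)" "x \<in> vcarrier A" "w \<in> vcarrier (dual V)"
      and q: "q = (y, z)" "y \<in> vcarrier A" "z \<in> vcarrier (dual V)" by auto
    show "?Q (mul W p q) = mul W p (?Q q) - mul W (der W p) q"
      using Q' p q by (auto simp: ev alpha_mu \<mu>Q dual_add)
    show "?Q (brk W p q) = brk W p (?Q q) - brk W (der W p) q"
      using Q' p q by (auto simp: ev alpha_rho \<rho>Q dual_add)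
  next
    fix p q s assume "p \<in> vcarrier W" "q \<in> vcarrier W" "s \<in> vcarrier W"
    then obtain x w y z t h where p: "p = (x, w)" "x \<in> vcarrier A" "w \<in> vcarrier (dual V)"
      and q: "q = (y, z)" "y \<in> vcarrier A" "z \<in> vcarrier (dual V)"
      and s: "s = (t, h)" "t \<in> vcarrier A" "h \<in> vcarrier (dual V)" by auto
    show "?Q (mul W (mul W p q) s) = brk W (mul W p q) s - brk W p (mul W q s) - brk W q (mul W p s)"
      using Q' p q s
      by (auto simp: ev rho_mul action_mul action_mul_comm dual_add dual_diff[OF vsV])
  qed
qed

end

locale semidirect_tensor = dual_semidirect A V \<mu> \<rho> \<beta>
  for A :: "('k::field, 'a::ab_group_add) rpa"
    and V :: "('k, 'v::ab_group_add) vsp" and \<mu> \<rho> \<beta> +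
  fixes T :: "'v \<Rightarrow> 'a" and B :: "'v set"
  assumes linT: "linmap V A T" and basis: "basis_of V B"
begin

definition r :: "('k, 'a \<times> ('v \<Rightarrow> 'k)) tensor2" where
  "r = map_tensor W V B T - flip (map_tensor W V B T)"

lemma T_closed [simp]: "v \<in> vcarrier V \<Longrightarrow> T v \<in> vcarrier A"
  using linT by (simp add: linmap_def)

lemma dual_T_closed [simp]: "f \<in> vcarrier (dual A) \<Longrightarrow> dual_map V T f \<in> vcarrier (dual V)"
  unfolding dual_map_def using linT
  by (intro mem_dual_guarded[OF vsV]) (auto simp: linmap_def dual_add dual_scale)

lemma map_tensor_mem: "map_tensor W V B T \<in> vcarrier (tensor W W)"
proof -
  have "tens W W (T v, 0) (0, coordinate V B v) \<in> vcarrier (tensor W W)" if "v \<in> B" for v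
    using bilinmap_tens[of W W] that basis_of_subset[OF vsV basis] coordinate_mem_dual[OF vsV basis]
      vspace_closed(1)[OF vsD]
    by (auto simp: bilinmap_def linmap_def)
  then show ?thesis unfolding map_tensor_def by (intro carrier_sum[OF vspace_tensor])
qed

lemma r_mem_tensor: "r \<in> vcarrier (tensor W W)"
  unfolding r_def by (intro carrier_diff[OF vspace_tensor] flip_mem_tensor map_tensor_mem)

lemma antisymmetric_r: "antisymmetric_tensor r"
  by (simp add: antisymmetric_tensor_def r_def flip_def fun_eq_iff)

text \<open>The sum \<open>\<Sum>\<^sub>b f(Tb) b\<^sup>*(v)\<close> is the dual basis expansion of \<open>f \<circ> T\<close> at \<open>v\<close>.\<close>

lemma map_tensor_eval:
  assumes f: "f \<in> vcarrier (dual A)" and g: "g \<in> vcarrier (dual A)" and v: "v \<in> vcarrier V"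
  shows "map_tensor W V B T (pairing f u) (pairing g v) = f (T v)"
proof -
  have B: "b \<in> B \<Longrightarrow> b \<in> vcarrier V" for b using basis_of_subset[OF vsV basis] by auto
  have "map_tensor W V B T (pairing f u) (pairing g v)
      = (\<Sum>b\<in>B. (dual_map V T f) b * coordinate V B b v)"
    unfolding map_tensor_def sum_fun_apply
    using f g B coordinate_mem_dual[OF vsV basis] vspace_closed(1)[OF vsD]
    by (intro sum.cong refl) (simp add: tens_def pairing_mem_dual dual_zero[OF vs] dual_map_def)
  also have "\<dots> = dual_map V T f v"
    using dual_coordinate_expansion[OF vsV basis basis_of_finite[OF fdV basis] dual_T_closed[OF f] v] by simp
  finally show ?thesis using v by (simp add: dual_map_def)
qed

lemma r_pairing:
  assumes "f \<in> vcarrier (dual A)" "u \<in> vcarrier V" "g \<in> vcarrier (dual A)" "v \<in> vcarrier V"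
  shows "r (pairing f u) (pairing g v) = f (T v) - g (T u)"
  using assms by (simp add: r_def flip_def map_tensor_eval)

text \<open>The operator of \<open>r\<close> is determined by its pairing with all functionals, so it is enough to compare
  \<open>r((f, u), (g, v)) = f(Tv) - g(Tu)\<close> with the pairing of \<open>(f, u)\<close> and \<open>(Tv, - T\<^sup>*g)\<close>.\<close>

lemma operator:
  obtains R where "antisymmetric_operator W r R"
    "\<And>g v. g \<in> vcarrier (dual A) \<Longrightarrow> v \<in> vcarrier V \<Longrightarrow> R (pairing g v) = (T v, - dual_map V T g)"
proof -
  obtain R where R: "antisymmetric_operator W r R"
    using antisymmetric_operator_exists[OF rpaW r_mem_tensor antisymmetric_r] by blast
  then interpret R: antisymmetric_operator W r R .
  have "R (pairing g v) = (T v, - dual_map V T g)" if g: "g \<in> vcarrier (dual A)" and v: "v \<in> vcarrier V" for g v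
  proof (rule dual_separates[OF W.vs])
    have m: "- dual_map V T g \<in> vcarrier (dual V)"
      using carrier_uminus[OF vsD dual_T_closed[OF g]] .
    show "R (pairing g v) \<in> vcarrier W" using pairing_mem_dual[OF g] R.R_closed by blast
    show "(T v, - dual_map V T g) \<in> vcarrier W" using m v by simp
    fix \<phi> assume "\<phi> \<in> vcarrier (dual W)"
    then obtain f u where fu: "f \<in> vcarrier (dual A)" "u \<in> vcarrier V" "\<phi> = pairing f u"
      by (rule dual_W_cases)
    have "\<phi> (R (pairing g v)) = r \<phi> (pairing g v)"
      using fu g by (simp add: R.r_eval pairing_mem_dual)
    also have "\<dots> = f (T v) - g (T u)" using fu g v by (simp add: r_pairing)
    also have "\<dots> = \<phi> (T v, - dual_map V T g)"
      using fu m v by (simp add: dual_map_def)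
    finally show "\<phi> (R (pairing g v)) = \<phi> (T v, - dual_map V T g)" .
  qed
  then show ?thesis using that R by blast
qed

text \<open>With \<open>R(g, v) = (Tv, - T\<^sup>*g)\<close> inserted, the trilinear identities are sums of one quadratic
  condition on \<open>T\<close> under each of three functionals on \<open>A\<close>; setting two of these to zero isolates
  a single copy.\<close>

lemma rpybe_iff_weak_O_operator:
  assumes Q: "linmap A A Q" and \<alpha>: "linmap V V \<alpha>"
  shows "rpybe_solution W (map_prod Q (dual_map V \<alpha>)) r \<longleftrightarrow>
    weak_O_operator A V \<mu> \<rho> \<alpha> T \<and> (\<forall>v\<in>vcarrier V. T (\<beta> v) = Q (T v))"
proof -
  let ?Q = "map_prod Q (dual_map V \<alpha>)" and ?A = "vcarrier (dual A)" and ?W = "vcarrier (dual W)"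
    and ?V = "vcarrier V"
  obtain R where R: "antisymmetric_operator W r R"
    and R_pairing: "\<And>g v. g \<in> ?A \<Longrightarrow> v \<in> ?V \<Longrightarrow> R (pairing g v) = (T v, - dual_map V T g)"
    by (rule operator) blast
  interpret R: antisymmetric_operator W r R by fact
  \<comment> \<open>Quantification over functionals on \<open>W\<close> is quantification over their components.\<close>
  have all_W: "(\<forall>\<phi>\<in>?W. P \<phi>) \<longleftrightarrow> (\<forall>f\<in>?A. \<forall>u\<in>?V. P (pairing f u))" for P
    using dual_W_cases pairing_mem_dual by metis
  have Qc [simp]: "x \<in> vcarrier A \<Longrightarrow> Q x \<in> vcarrier A" for x using Q by (simp add: linmap_def)
  have \<alpha>c [simp]: "v \<in> ?V \<Longrightarrow> \<alpha> v \<in> ?V" for v using \<alpha> by (simp add: linmap_def)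
  have QW: "linmap W W ?Q"
    using Q linmap_dual_map[OF vsV \<alpha>] by (auto simp: linmap_def W_scale)

  have T_lin: "T (v + w) = T v + T w" "T (v - w) = T v - T w" if "v \<in> ?V" "w \<in> ?V" for v w
    using linT linmap_diff[OF vsV linT] that by (auto simp: linmap_def)
  have tri_mul: "pairing f u (mul W (R (pairing g v)) (R (pairing h w)))
      = f (mul A (T v) (T w)) - h (T (\<mu> (T v) u)) - g (T (\<mu> (T w) u))"
    if "f \<in> ?A" "u \<in> ?V" "g \<in> ?A" "v \<in> ?V" "h \<in> ?A" "w \<in> ?V" for f u g v h w
    using that by (simp add: R_pairing) (simp add: dual_action_def dual_map_def)
  have tri_brk: "pairing f u (brk W (R (pairing g v)) (R (pairing h w)))
      = f (brk A (T v) (T w)) + h (T (\<rho> (T v) u)) - g (T (\<rho> (T w) u))"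
    if "f \<in> ?A" "u \<in> ?V" "g \<in> ?A" "v \<in> ?V" "h \<in> ?A" "w \<in> ?V" for f u g v h w
    using that by (simp add: R_pairing) (simp add: dual_action_def dual_map_def)
  have zero: "0 \<in> ?A" using vspace_closed(1)[OF vspace_dual[OF vs]] .
  have T0: "T 0 = 0" "\<mu> x 0 = 0" "\<rho> x 0 = 0" if "x \<in> vcarrier A" for x
    using linmap_zero[OF vsV] linT bilinmap_actions that unfolding bilinmap_def by blast+
  have mul: "(\<forall>\<phi>\<in>?W. \<forall>\<psi>\<in>?W. \<forall>\<chi>\<in>?W.
      \<phi> (mul W (R \<psi>) (R \<chi>)) + \<psi> (mul W (R \<phi>) (R \<chi>)) + \<chi> (mul W (R \<phi>) (R \<psi>)) = 0) \<longleftrightarrow>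
      (\<forall>v\<in>?V. \<forall>w\<in>?V. mul A (T v) (T w) = T (\<mu> (T v) w + \<mu> (T w) v))" (is "?l \<longleftrightarrow> ?r")
  proof
    assume l: ?l
    show ?r
    proof (intro ballI)
      fix v w assume v: "v \<in> ?V" "w \<in> ?V"
      show "mul A (T v) (T w) = T (\<mu> (T v) w + \<mu> (T w) v)"
      proof (rule dual_separates[OF vs])
        fix f assume f: "f \<in> ?A"
        show "f (mul A (T v) (T w)) = f (T (\<mu> (T v) w + \<mu> (T w) v))"
          using l[unfolded all_W, rule_format, OF f closedV(1) zero v(1) zero v(2)] f v zero
          by (simp add: tri_mul T_lin dual_add T0 dual_zero[OF vs] algebra_simps)
      qed (use v in simp_all)
    qed
  next
    assume r: ?r
    have e: "f (mul A (T v) (T w)) = f (T (\<mu> (T v) w)) + f (T (\<mu> (T w) v))" if "f \<in> ?A" "v \<in> ?V" "w \<in> ?V" for f v w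
      using r that by (simp add: T_lin dual_add)
    show ?l unfolding all_W by (simp add: tri_mul e)
  qed
  have brk: "(\<forall>\<phi>\<in>?W. \<forall>\<psi>\<in>?W. \<forall>\<chi>\<in>?W.
      \<phi> (brk W (R \<psi>) (R \<chi>)) - \<psi> (brk W (R \<phi>) (R \<chi>)) + \<chi> (brk W (R \<phi>) (R \<psi>)) = 0) \<longleftrightarrow>
      (\<forall>v\<in>?V. \<forall>w\<in>?V. brk A (T v) (T w) = T (\<rho> (T v) w - \<rho> (T w) v))" (is "?l \<longleftrightarrow> ?r")
  proof
    assume l: ?l
    show ?r
    proof (intro ballI)
      fix v w assume v: "v \<in> ?V" "w \<in> ?V"
      show "brk A (T v) (T w) = T (\<rho> (T v) w - \<rho> (T w) v)"
      proof (rule dual_separates[OF vs])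
        fix f assume f: "f \<in> ?A"
        show "f (brk A (T v) (T w)) = f (T (\<rho> (T v) w - \<rho> (T w) v))"
          using l[unfolded all_W, rule_format, OF f closedV(1) zero v(1) zero v(2)] f v zero
          by (simp add: tri_brk T_lin dual_diff[OF vs] T0 dual_zero[OF vs] algebra_simps)
      qed (use v in simp_all)
    qed
  next
    assume r: ?r
    have e: "f (brk A (T v) (T w)) = f (T (\<rho> (T v) w)) - f (T (\<rho> (T w) v))" if "f \<in> ?A" "v \<in> ?V" "w \<in> ?V" for f v w
      using r that by (simp add: T_lin dual_diff[OF vs])
    show ?l unfolding all_W by (simp add: tri_brk e)
  qed
  \<comment> \<open>Pulling back along \<open>Q + \<alpha>\<^sup>*\<close> or \<open>P + \<beta>\<^sup>*\<close> acts on the two components of a functional separately.\<close>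
  have pull_Q: "dual_map W ?Q (pairing g v) = pairing (dual_map A Q g) (\<alpha> v)"
    and pull_der: "dual_map W (der W) (pairing g v) = pairing (dual_map A (der A) g) (\<beta> v)"
    if "g \<in> ?A" "v \<in> ?V" for g v
    using that \<alpha> linmap_beta by (auto simp: fun_eq_iff dual_map_def[of W] pairing_def)
      (auto simp: dual_map_def)
  have dc: "dual_map A Q g \<in> ?A" "dual_map A (der A) g \<in> ?A" if "g \<in> ?A" for g
    using dual_map_mem[OF vs] Q linmap_der that by auto
  \<comment> \<open>The component in \<open>A\<close> of each intertwining condition is one of \<open>PT = T\<alpha>\<close>, \<open>QT = T\<beta>\<close>, and
      the component in \<open>V\<^sup>*\<close> is the transpose of the other one; so the two conditions are equivalent.\<close>
  have 3: "(\<forall>\<phi>\<in>?W. der W (R \<phi>) = R (dual_map W ?Q \<phi>)) \<longleftrightarrow>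
      (\<forall>g\<in>?A. \<forall>v\<in>?V. der A (T v) = T (\<alpha> v) \<and> (\<forall>x\<in>?V. g (T (\<beta> x)) = g (Q (T x))))"
    unfolding all_W by (intro ball_cong refl)
      (simp add: pull_Q R_pairing dc, auto simp: dual_map_def fun_eq_iff)
  have 4: "(\<forall>\<phi>\<in>?W. ?Q (R \<phi>) = R (dual_map W (der W) \<phi>)) \<longleftrightarrow>
      (\<forall>g\<in>?A. \<forall>v\<in>?V. Q (T v) = T (\<beta> v) \<and> (\<forall>x\<in>?V. g (T (\<alpha> x)) = g (der A (T x))))"
    unfolding all_W by (intro ball_cong refl)
      (simp add: pull_der R_pairing dc, auto simp: dual_map_def fun_eq_iff)
  show ?thesis
    unfolding R.rpybe_solution_iff_operator[OF QW] mul brk 3 4 weak_O_operator_def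
    using linT zero by auto
qed

end

theorem theorem4p13:
  fixes A :: "('k::{alg_closed_field, field_char_0}, 'a::ab_group_add) rpa"
    and V :: "('k, 'v::ab_group_add) vsp"
    and \<mu> \<rho> :: "'a \<Rightarrow> 'v \<Rightarrow> 'v"
    and \<alpha> \<beta> :: "'v \<Rightarrow> 'v"
    and Q :: "'a \<Rightarrow> 'a"
    and T :: "'v \<Rightarrow> 'a"
    and B :: "'v set"
  assumes "relative_poisson_algebra A"
    and "compatible_structure A V \<mu> \<rho>"
    and "linmap V V \<beta>"
    and "dually_represents_on A V \<mu> \<rho> \<beta>"
    and "linmap A A Q"
    and "linmap V V \<alpha>"
    and "linmap V A T"
    and "basis_of V B"
  shows
    "let W = semidirect A (dual V) (- dual_action V \<mu>) (dual_action V \<rho>) (dual_map V \<beta>);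
         QW = map_prod Q (dual_map V \<alpha>);
         r = map_tensor W V B T - flip (map_tensor W V B T)
     in (antisymmetric_tensor r \<and> rpybe_solution W QW r \<longleftrightarrow>
           weak_O_operator A V \<mu> \<rho> \<alpha> T \<and> (\<forall>v\<in>vcarrier V. T (\<beta> v) = Q (T v)))
      \<and> (dually_represents A Q \<and> rpa_rep A V \<mu> \<rho> \<alpha> \<longrightarrow>
           O_operator A V \<mu> \<rho> \<alpha> T \<and> (\<forall>v\<in>vcarrier V. T (\<beta> v) = Q (T v)) \<longrightarrow>
             antisymmetric_tensor r \<and> rpybe_solution W QW r
           \<and> ((\<forall>x\<in>vcarrier A. \<forall>v\<in>vcarrier V.
                  \<mu> (Q x) v - \<mu> x (\<alpha> v) - \<beta> (\<mu> x v) = 0 \<and>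
                  \<rho> (Q x) v - \<rho> x (\<alpha> v) - \<beta> (\<rho> x v) = 0) \<longrightarrow>
               dually_represents W QW
             \<and> relative_poisson_bialgebra W
                 (\<lambda>u. tensor_map W id (mul W u) r - tensor_map W (mul W u) id r)
                 (\<lambda>u. tensor_map W (brk W u) id r + tensor_map W id (brk W u) r)
                 QW))"
proof -
  interpret S: semidirect_tensor A V \<mu> \<rho> \<beta> T B
    by unfold_locales fact+
  have iff: "rpybe_solution S.W (map_prod Q (dual_map V \<alpha>)) S.r \<longleftrightarrow>
      weak_O_operator A V \<mu> \<rho> \<alpha> T \<and> (\<forall>v\<in>vcarrier V. T (\<beta> v) = Q (T v))"
    by (rule S.rpybe_iff_weak_O_operator) fact+
  have dual: "dually_represents S.W (map_prod Q (dual_map V \<alpha>))"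
    if "dually_represents A Q" "rpa_rep A V \<mu> \<rho> \<alpha>"
      and "\<forall>x\<in>vcarrier A. \<forall>v\<in>vcarrier V.
        \<mu> (Q x) v - \<mu> x (\<alpha> v) - \<beta> (\<mu> x v) = 0 \<and> \<rho> (Q x) v - \<rho> x (\<alpha> v) - \<beta> (\<rho> x v) = 0"
    using that by (intro S.dually_represents_semidirect) (simp_all add: algebra_simps)
  show ?thesis
    unfolding Let_def S.W_def[symmetric] S.r_def[symmetric]
    using iff dual S.antisymmetric_r coboundary_bialgebra[OF S.rpaW]
    by (auto simp: O_operator_def)
qed

end
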